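(* The grand maximal operator $\mathcal{GM}$, defined by $$\mathcal{GM} f(x) = \sup_{0<\delta<1/2} \frac{1}{|\log \delta|}\, M_\delta f(x), \qquad x\in\mathbb{R}^2,$$ is bounded on $L^2(\mathbb{R}^2)$; that is, there is an absolute constant $C<\infty$ such that $\|\mathcal{GM} f\|_{L^2(\mathbb{R}^2)} \le C\,\|f\|_{L^2(\mathbb{R}^2)}$ for every $f\in L^2(\mathbb{R}^2)$.
   Context: For $0<\delta<1/2$, $M_\delta$ denotes the maximal operator with respect to the basis of $h\times\delta h$ rectangles in the plane, i.e. $$M_\delta f(x) = \sup_{x\in R} \frac{1}{|R|}\int_R |f(y)|\,dy,$$ where the supremum is over all rectangles $R\subset\mathbb{R}^2$ containing $x$, of arbitrary orientation, with side lengths $h$ and $\delta h$ for some arbitrary $h>0$ (with $\delta$ fixed). Here $|R|$ is the Lebesgue measure of $R$. *)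

theory Defs
  imports "HOL-Analysis.Analysis"
begin

text \<open>
  Rectangles are closed, with a corner \<open>p\<close> and orthonormal side directions \<open>u\<close>, \<open>v\<close>.
  Taking them open would give the same maximal functions.
\<close>

definition rectangle :: "real^2 \<Rightarrow> real^2 \<Rightarrow> real^2 \<Rightarrow> real \<Rightarrow> real \<Rightarrow> (real^2) set" where
  "rectangle p u v a b = {p + s *\<^sub>R u + t *\<^sub>R v | s t. 0 \<le> s \<and> s \<le> a \<and> 0 \<le> t \<and> t \<le> b}"

definition rectangles :: "real \<Rightarrow> (real^2) set set" where
  "rectangles \<delta> = {rectangle p u v h (\<delta> * h) | p u v h.
     norm u = 1 \<and> norm v = 1 \<and> u \<bullet> v = 0 \<and> 0 < h}"

text \<open>
  Maximal functions take values in \<^typ>\<open>ennreal\<close>, since the suprema may be infinite at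
  individual points.
\<close>

definition average :: "(real^2 \<Rightarrow> complex) \<Rightarrow> (real^2) set \<Rightarrow> ennreal" where
  "average f R = (\<integral>\<^sup>+ y \<in> R. ennreal (norm (f y)) \<partial>lebesgue) / emeasure lebesgue R"

definition maximal :: "real \<Rightarrow> (real^2 \<Rightarrow> complex) \<Rightarrow> real^2 \<Rightarrow> ennreal" where
  "maximal \<delta> f x = (SUP R \<in> {R \<in> rectangles \<delta>. x \<in> R}. average f R)"

definition grand_maximal :: "(real^2 \<Rightarrow> complex) \<Rightarrow> real^2 \<Rightarrow> ennreal" where
  "grand_maximal f x = (SUP \<delta> \<in> {0<..<1/2}. ennreal (1 / \<bar>ln \<delta>\<bar>) * maximal \<delta> f x)"

definition ennreal_sqrt :: "ennreal \<Rightarrow> ennreal" where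
  "ennreal_sqrt x = (if x = \<infinity> then \<infinity> else ennreal (sqrt (enn2real x)))"

text \<open>
  The \<open>L\<^sup>2\<close> norm of a nonnegative extended-valued function; for complex \<open>f\<close> it is applied to
  the modulus of \<open>f\<close>. It is the usual norm only for measurable functions.
\<close>

definition L2_norm :: "(real^2 \<Rightarrow> ennreal) \<Rightarrow> ennreal" where
  "L2_norm g = ennreal_sqrt (\<integral>\<^sup>+ x. (g x)\<^sup>2 \<partial>lebesgue)"

definition L2 :: "(real^2 \<Rightarrow> complex) set" where
  "L2 = {f. f \<in> borel_measurable lebesgue \<and> L2_norm (\<lambda>x. ennreal (norm (f x))) < \<infinity>}"

end

theory Submission
  imports Defs
begin

text \<open>
  One \<open>T T\<^sup>*\<close> computation reduces the theorem to the Hardy--Littlewood maximal inequality.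

  Linearise the supremum: to each \<open>x\<close> attach a rectangle \<open>R(x)\<close> containing \<open>x\<close>, of size
  \<open>h(x) \<times> \<delta>(x) h(x)\<close>, and put \<open>\<kappa>(x) = 1 / \<bar>ln \<delta>(x)\<bar>\<close>. The adjoint operator is
  \<open>T\<^sup>* g(y) = \<integral> \<kappa>(x) g(x) 1\<^bsub>R(x)\<^esub>(y) / |R(x)| dx\<close>, and \<open>\<parallel>T\<^sup>* g\<parallel>\<^sup>2\<close> is the double integral of
  \<open>g(x) g(x')\<close> against \<open>\<kappa>(x) \<kappa>(x') |R(x) \<inter> R(x')| / (|R(x)| |R(x')|)\<close>. By symmetry only pairs with
  \<open>h(x') \<le> h(x)\<close> matter. For such a pair, elementary geometry shows that
  \<open>|R(x) \<inter> R(x')| / |R(x')|\<close> is at most a constant times \<open>r\<^sup>-\<^sup>2 |6R(x) \<inter> B(x', r)|\<close> for a suitable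
  dyadic multiple \<open>r\<close> of the width \<open>\<delta>(x') h(x')\<close> with \<open>r\<close> at most a constant times \<open>h(x')\<close>. Only
  about \<open>1 / \<kappa>(x')\<close> values of \<open>r\<close> are possible, so the factor \<open>\<kappa>(x')\<close> turns the sum over all of them
  into a bounded superposition of disc averages about \<open>x'\<close>: the logarithmic weight of the shorter
  rectangle pays for its scales, and that of the longer one is left to form \<open>T\<^sup>*\<close> again. Hence
  \<open>\<parallel>T\<^sup>* g\<parallel>\<^sup>2 \<le> C \<langle>T\<^sub>6\<^sup>* g, H\<^sup>* g\<rangle>\<close>, where \<open>T\<^sub>6\<close> uses the rectangles dilated by \<open>6\<close> and \<open>H\<close> is dominated
  pointwise by the Hardy--Littlewood maximal operator, so that \<open>\<parallel>H\<^sup>* g\<parallel> \<le> C \<parallel>g\<parallel>\<close>.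

  Applied to the dilates by \<open>6\<^sup>n\<close> this reads \<open>b\<^sub>n\<^sup>2 \<le> C \<parallel>g\<parallel> b\<^sub>n\<^sub>+\<^sub>1\<close> for the norms \<open>b\<^sub>n\<close> of the
  dilated adjoints. When only finitely many rectangles are used, \<open>b\<^sub>n\<close> is bounded in \<open>n\<close>, and then
  the inequality forces \<open>b\<^sub>0 \<le> C \<parallel>g\<parallel>\<close> (\<open>bounded_square_iteration\<close>) with \<open>C\<close> independent of the
  family. The bound for \<open>H\<^sup>*\<close> (\<open>ball_superposition_L2_bound\<close>) follows from the same scheme with
  discs in place of rectangles, and the geometry is \<open>crect_Int_measure_le\<close>.

  Finally, a slight dilation of a rectangle changes its average only slightly, so by the Lindelof
  property the supremum over all rectangles equals one over a countable family. This gives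
  measurability, and monotone convergence extends the bound from finite families.
\<close>

section \<open>Sums of squares and a bootstrapping inequality\<close>

lemma ennreal_mult_assoc:
  "0 \<le> w \<Longrightarrow> 0 \<le> p \<Longrightarrow> ennreal w * (ennreal p * X) = ennreal (w * p) * X"
  by (simp add: ennreal_mult mult.assoc)

lemma sum_square_le_card:
  fixes U :: "'i \<Rightarrow> ennreal"
  shows "(\<Sum>i\<in>I. U i)\<^sup>2 \<le> 2 * of_nat (card I) * (\<Sum>i\<in>I. (U i)\<^sup>2)"
proof -
  have *: "x * y \<le> x\<^sup>2 + y\<^sup>2" for x y :: ennreal
  proof (cases "x \<le> y")
    case True
    then have "x * y \<le> y\<^sup>2" by (simp add: power2_eq_square mult_right_mono)
    then show ?thesis by (simp add: add_increasing)
  next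
    case False
    then have "x * y \<le> x\<^sup>2" by (simp add: power2_eq_square mult_left_mono)
    then show ?thesis by (simp add: add_increasing2)
  qed
  have "(\<Sum>i\<in>I. U i)\<^sup>2 = (\<Sum>i\<in>I. \<Sum>j\<in>I. U i * U j)"
    by (simp add: power2_eq_square sum_product)
  also have "\<dots> \<le> (\<Sum>i\<in>I. \<Sum>j\<in>I. (U i)\<^sup>2 + (U j)\<^sup>2)"
    by (intro sum_mono *)
  also have "\<dots> = 2 * of_nat (card I) * (\<Sum>i\<in>I. (U i)\<^sup>2)"
    by (simp add: sum.distrib mult_2 distrib_right flip: sum_distrib_left)
  finally show ?thesis .
qed

text \<open>
  The expansion of a square is symmetric, so it suffices to keep the pairs in which the second
  member is the smaller one.
\<close>

lemma sum_square_le_ordered_pairs: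
  fixes U :: "'i \<Rightarrow> ennreal" and size :: "'i \<Rightarrow> real"
  assumes "finite I"
  shows "(\<Sum>i\<in>I. U i)\<^sup>2 \<le> 2 * (\<Sum>i\<in>I. \<Sum>j\<in>{j\<in>I. size j \<le> size i}. U i * U j)"
proof -
  let ?S = "\<Sum>i\<in>I. \<Sum>j\<in>I. if size j \<le> size i then U i * U j else 0"
  have "(\<Sum>i\<in>I. U i)\<^sup>2 = (\<Sum>i\<in>I. \<Sum>j\<in>I. U i * U j)"
    by (simp add: power2_eq_square sum_product)
  also have "\<dots> \<le> (\<Sum>i\<in>I. \<Sum>j\<in>I. (if size j \<le> size i then U i * U j else 0)
      + (if size i \<le> size j then U j * U i else 0))"
    by (intro sum_mono) (auto simp: mult.commute)
  also have "\<dots> = ?S + (\<Sum>i\<in>I. \<Sum>j\<in>I. if size i \<le> size j then U j * U i else 0)"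
    by (simp add: sum.distrib)
  also have "(\<Sum>i\<in>I. \<Sum>j\<in>I. if size i \<le> size j then U j * U i else 0) = ?S"
    by (rule sum.swap)
  also have "?S = (\<Sum>i\<in>I. \<Sum>j\<in>{j\<in>I. size j \<le> size i}. U i * U j)"
    by (rule sum.cong[OF refl]) (simp add: sum.inter_filter[OF assms])
  finally show ?thesis by (simp add: mult_2)
qed

text \<open>
  If \<open>Q 0 > D\<close>, then \<open>Q n / D\<close> at least squares at every step and is therefore unbounded. This
  is what allows an estimate to bound a quantity by its own dilate: mere boundedness over all
  dilates, with no control of the bound, already yields the constant \<open>D\<close>.
\<close>

lemma bounded_square_iteration:
  fixes Q :: "nat \<Rightarrow> ennreal"
  assumes step: "\<And>n. (Q n)\<^sup>2 \<le> D * Q (Suc n)"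
    and bounded: "\<And>n. Q n \<le> B" "B < \<infinity>"
  shows "Q 0 \<le> D"
proof (cases "D = \<infinity> \<or> D = 0")
  case True
  then show ?thesis using step[of 0] by auto
next
  case False
  then obtain d where d: "D = ennreal d" "0 < d"
    by (cases D) auto
  obtain b where b: "B = ennreal b" "0 \<le> b"
    using bounded(2) by (cases B) auto
  define q where "q n = enn2real (Q n)" for n
  have Q: "Q n = ennreal (q n)" for n
    using bounded(1)[of n] bounded(2) unfolding q_def by (simp add: order_le_less_trans)
  have q0: "0 \<le> q n" for n by (simp add: q_def)
  have qb: "q n \<le> b" for n
    using bounded(1)[of n] b by (simp add: Q)
  have qs: "(q n)\<^sup>2 \<le> d * q (Suc n)" for n
    using step[of n] d q0 by (simp add: Q ennreal_power flip: ennreal_mult)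
  have "q 0 \<le> d"
  proof (rule ccontr)
    assume "\<not> q 0 \<le> d"
    define c where "c = q 0 / d"
    have c: "1 < c" using \<open>\<not> q 0 \<le> d\<close> d by (simp add: c_def)
    have growth: "d * c ^ Suc n \<le> q n" for n
    proof (induction n)
      case 0
      then show ?case using d by (simp add: c_def)
    next
      case (Suc n)
      have "d * (d * c ^ Suc (Suc n)) \<le> d * (d * c ^ (2 * Suc n))"
        using c d by (intro mult_left_mono power_increasing) auto
      also have "\<dots> = (d * c ^ Suc n)\<^sup>2"
        by (simp only: power_mult_distrib power_mult[symmetric] power2_eq_square[of d])
          (simp add: mult.commute mult.left_commute)
      also have "\<dots> \<le> (q n)\<^sup>2" using Suc c d by (intro power_mono) auto
      also have "\<dots> \<le> d * q (Suc n)" by (rule qs)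
      finally show ?case using d by simp
    qed
    obtain n where "b / d < c ^ n" using real_arch_pow[OF c] by blast
    also have "c ^ n \<le> c ^ Suc n" using c by (intro power_increasing) auto
    finally have "b < d * c ^ Suc n" using d by (simp add: divide_less_eq mult.commute)
    with growth[of n] qb[of n] show False by linarith
  qed
  then show ?thesis by (simp add: Q d ennreal_leI)
qed

section \<open>Superpositions of disc averages\<close>

lemma measurable_indicator_cball [measurable]:
  "(\<lambda>z. indicator (cball (fst z) \<rho>) (snd z) :: ennreal)
     \<in> borel_measurable ((lborel :: (real^2) measure) \<Otimes>\<^sub>M lborel)"
proof -
  have "closed {z :: (real^2) \<times> (real^2). dist (fst z) (snd z) \<le> \<rho>}"
    by (intro closed_Collect_le continuous_intros)
  then have "{z :: (real^2) \<times> (real^2). dist (fst z) (snd z) \<le> \<rho>}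
      \<in> sets ((lborel :: (real^2) measure) \<Otimes>\<^sub>M lborel)"
    unfolding lborel_prod by (simp add: borel_closed)
  then have "indicator {z :: (real^2) \<times> (real^2). dist (fst z) (snd z) \<le> \<rho>}
      \<in> (borel_measurable ((lborel :: (real^2) measure) \<Otimes>\<^sub>M lborel) :: ((real^2) \<times> (real^2) \<Rightarrow> ennreal) set)"
    by (rule borel_measurable_indicator)
  then show ?thesis
    by (rule measurable_cong[THEN iffD1, rotated]) (auto simp: indicator_def)
qed

lemma measurable_ball_integral [measurable]:
  fixes \<phi> :: "real^2 \<Rightarrow> ennreal"
  assumes [measurable]: "\<phi> \<in> borel_measurable lborel"
  shows "(\<lambda>y. \<integral>\<^sup>+x. \<phi> x * indicator (cball y \<rho>) x \<partial>lborel) \<in> borel_measurable lborel"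
proof -
  have "(\<lambda>z. \<phi> (snd z) * indicator (cball (fst z) \<rho>) (snd z))
      \<in> borel_measurable ((lborel :: (real^2) measure) \<Otimes>\<^sub>M lborel)"
    by measurable
  then show ?thesis
    using lborel.borel_measurable_nn_integral
      [of "\<lambda>y x. \<phi> x * indicator (cball y \<rho>) x" "lborel :: (real^2) measure"]
    by (simp add: case_prod_beta')
qed

lemma nn_integral_ball_swap:
  fixes \<phi> \<psi> :: "real^2 \<Rightarrow> ennreal"
  assumes [measurable]: "\<phi> \<in> borel_measurable lborel" "\<psi> \<in> borel_measurable lborel"
  shows "(\<integral>\<^sup>+y. \<psi> y * (\<integral>\<^sup>+x. \<phi> x * indicator (cball y \<rho>) x \<partial>lborel) \<partial>lborel)
    = (\<integral>\<^sup>+x. \<phi> x * (\<integral>\<^sup>+y. \<psi> y * indicator (cball x \<rho>) y \<partial>lborel) \<partial>lborel)"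
proof -
  have ind: "indicator (cball y \<rho>) x = (indicator (cball x \<rho>) y :: ennreal)" for x y :: "real^2"
    by (simp add: indicator_def dist_commute)
  have meas: "(\<lambda>z. \<psi> (fst z) * (\<phi> (snd z) * indicator (cball (fst z) \<rho>) (snd z)))
      \<in> borel_measurable ((lborel :: (real^2) measure) \<Otimes>\<^sub>M lborel)"
    by measurable
  have [measurable]: "(indicator (cball y \<rho>) :: real^2 \<Rightarrow> ennreal) \<in> borel_measurable lborel" for y
    by (intro borel_measurable_indicator) simp
  have "(\<integral>\<^sup>+y. \<psi> y * (\<integral>\<^sup>+x. \<phi> x * indicator (cball y \<rho>) x \<partial>lborel) \<partial>lborel)
      = (\<integral>\<^sup>+y. (\<integral>\<^sup>+x. \<psi> y * (\<phi> x * indicator (cball y \<rho>) x) \<partial>lborel) \<partial>lborel)"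
    by (intro nn_integral_cong nn_integral_cmult[symmetric]) measurable
  also have "\<dots> = (\<integral>\<^sup>+x. (\<integral>\<^sup>+y. \<psi> y * (\<phi> x * indicator (cball y \<rho>) x) \<partial>lborel) \<partial>lborel)"
    using meas by (intro lborel_pair.Fubini'[symmetric]) (simp add: case_prod_beta')
  also have "\<dots> = (\<integral>\<^sup>+x. (\<integral>\<^sup>+y. \<phi> x * (\<psi> y * indicator (cball x \<rho>) y) \<partial>lborel) \<partial>lborel)"
    by (simp add: ind mult_ac)
  also have "\<dots> = (\<integral>\<^sup>+x. \<phi> x * (\<integral>\<^sup>+y. \<psi> y * indicator (cball x \<rho>) y \<partial>lborel) \<partial>lborel)"
    by (intro nn_integral_cong nn_integral_cmult) measurable
  finally show ?thesis .
qed

lemma emeasure_disc: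
  "0 \<le> \<rho> \<Longrightarrow> emeasure lborel (cball (x :: real^2) \<rho>) = ennreal (pi * \<rho>\<^sup>2)"
  by (simp add: emeasure_cball unit_ball_vol_2)

text \<open>
  A disc of radius \<open>\<sigma> \<le> \<rho>\<close> about \<open>x'\<close> and one of radius \<open>\<rho>\<close> about \<open>x\<close> can only meet when \<open>x\<close> is
  within \<open>2 * \<rho>\<close> of \<open>x'\<close>, and their intersection has area at most \<open>pi * \<sigma>\<^sup>2\<close>.
\<close>

lemma nn_integral_ball_product_le:
  fixes \<phi> \<psi> :: "real^2 \<Rightarrow> ennreal"
  assumes [measurable]: "\<phi> \<in> borel_measurable lborel" "\<psi> \<in> borel_measurable lborel"
    and "0 \<le> \<sigma>" "\<sigma> \<le> \<rho>"
  shows "(\<integral>\<^sup>+y. (\<integral>\<^sup>+x. \<phi> x * indicator (cball y \<rho>) x \<partial>lborel)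
             * (\<integral>\<^sup>+x. \<psi> x * indicator (cball y \<sigma>) x \<partial>lborel) \<partial>lborel)
    \<le> ennreal (pi * \<sigma>\<^sup>2)
      * (\<integral>\<^sup>+x'. \<psi> x' * (\<integral>\<^sup>+x. \<phi> x * indicator (cball x' (2 * \<rho>)) x \<partial>lborel) \<partial>lborel)"
proof -
  let ?W = "\<lambda>y s. \<integral>\<^sup>+x. \<phi> x * indicator (cball y s) x \<partial>lborel"
  have "(\<integral>\<^sup>+y. ?W y \<rho> * (\<integral>\<^sup>+x. \<psi> x * indicator (cball y \<sigma>) x \<partial>lborel) \<partial>lborel)
      = (\<integral>\<^sup>+x'. \<psi> x' * (\<integral>\<^sup>+y. ?W y \<rho> * indicator (cball x' \<sigma>) y \<partial>lborel) \<partial>lborel)"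
    by (rule nn_integral_ball_swap) measurable
  also have "\<dots> \<le> (\<integral>\<^sup>+x'. \<psi> x' * (?W x' (2 * \<rho>) * ennreal (pi * \<sigma>\<^sup>2)) \<partial>lborel)"
  proof (intro nn_integral_mono mult_left_mono)
    fix x'
    have "?W y \<rho> \<le> ?W x' (2 * \<rho>)" if "y \<in> cball x' \<sigma>" for y
    proof (intro nn_integral_mono mult_left_mono indicator_leI)
      fix x assume "x \<in> cball y \<rho>"
      then show "x \<in> cball x' (2 * \<rho>)"
        using that dist_triangle[of x' x y] assms by simp
    qed simp
    then have "(\<integral>\<^sup>+y. ?W y \<rho> * indicator (cball x' \<sigma>) y \<partial>lborel)
        \<le> (\<integral>\<^sup>+y. ?W x' (2 * \<rho>) * indicator (cball x' \<sigma>) y \<partial>lborel)"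
      by (intro nn_integral_mono) (auto simp: indicator_def)
    also have "\<dots> = ?W x' (2 * \<rho>) * ennreal (pi * \<sigma>\<^sup>2)"
      using assms by (simp add: nn_integral_cmult_indicator emeasure_disc)
    finally show "(\<integral>\<^sup>+y. ?W y \<rho> * indicator (cball x' \<sigma>) y \<partial>lborel)
        \<le> ?W x' (2 * \<rho>) * ennreal (pi * \<sigma>\<^sup>2)" .
  qed simp
  also have "\<dots> = (\<integral>\<^sup>+x'. ennreal (pi * \<sigma>\<^sup>2) * (\<psi> x' * ?W x' (2 * \<rho>)) \<partial>lborel)"
    by (simp add: mult_ac)
  also have "\<dots> = ennreal (pi * \<sigma>\<^sup>2) * (\<integral>\<^sup>+x'. \<psi> x' * ?W x' (2 * \<rho>) \<partial>lborel)"
    by (intro nn_integral_cmult) measurable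
  finally show ?thesis .
qed

lemma nn_integral_ball_average_square_le:
  fixes \<phi> :: "real^2 \<Rightarrow> ennreal"
  assumes [measurable]: "\<phi> \<in> borel_measurable lborel" and "0 < \<rho>"
  shows "(\<integral>\<^sup>+y. (ennreal (1 / \<rho>\<^sup>2) * (\<integral>\<^sup>+x. \<phi> x * indicator (cball y \<rho>) x \<partial>lborel))\<^sup>2 \<partial>lborel)
    \<le> ennreal (pi\<^sup>2) * (\<integral>\<^sup>+x. (\<phi> x)\<^sup>2 \<partial>lborel)"
proof -
  let ?w = "ennreal (1 / \<rho>\<^sup>2)"
  have [measurable]: "(indicator (cball y \<rho>) :: real^2 \<Rightarrow> ennreal) \<in> borel_measurable lborel" for y
    by (intro borel_measurable_indicator) simp
  have CS: "(\<integral>\<^sup>+x. \<phi> x * indicator (cball y \<rho>) x \<partial>lborel)\<^sup>2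
      \<le> (\<integral>\<^sup>+x. (\<phi> x)\<^sup>2 * indicator (cball y \<rho>) x \<partial>lborel) * ennreal (pi * \<rho>\<^sup>2)" for y
  proof -
    have "(\<integral>\<^sup>+x. \<phi> x * indicator (cball y \<rho>) x \<partial>lborel)
        = (\<integral>\<^sup>+x. (\<phi> x * indicator (cball y \<rho>) x) * indicator (cball y \<rho>) x \<partial>lborel)"
      by (intro nn_integral_cong) (simp add: indicator_def)
    also have "\<dots>\<^sup>2 \<le> (\<integral>\<^sup>+x. (\<phi> x * indicator (cball y \<rho>) x)\<^sup>2 \<partial>lborel)
        * (\<integral>\<^sup>+x. (indicator (cball y \<rho>) x)\<^sup>2 \<partial>lborel)"
      by (intro Cauchy_Schwarz_nn_integral) measurable
    also have "(\<integral>\<^sup>+x. (\<phi> x * indicator (cball y \<rho>) x)\<^sup>2 \<partial>lborel)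
        = (\<integral>\<^sup>+x. (\<phi> x)\<^sup>2 * indicator (cball y \<rho>) x \<partial>lborel)"
      by (intro nn_integral_cong) (simp add: indicator_def)
    also have "(\<integral>\<^sup>+x. (indicator (cball y \<rho>) x :: ennreal)\<^sup>2 \<partial>lborel)
        = (\<integral>\<^sup>+x. indicator (cball y \<rho>) x \<partial>lborel)"
      by (intro nn_integral_cong) (simp add: indicator_def)
    also have "\<dots> = ennreal (pi * \<rho>\<^sup>2)" using assms by (simp add: emeasure_disc)
    finally show ?thesis .
  qed
  have "(\<integral>\<^sup>+y. (?w * (\<integral>\<^sup>+x. \<phi> x * indicator (cball y \<rho>) x \<partial>lborel))\<^sup>2 \<partial>lborel)
      \<le> (\<integral>\<^sup>+y. (?w\<^sup>2 * ennreal (pi * \<rho>\<^sup>2)) * (\<integral>\<^sup>+x. (\<phi> x)\<^sup>2 * indicator (cball y \<rho>) x \<partial>lborel) \<partial>lborel)"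
  proof (intro nn_integral_mono)
    fix y
    show "(?w * (\<integral>\<^sup>+x. \<phi> x * indicator (cball y \<rho>) x \<partial>lborel))\<^sup>2
        \<le> (?w\<^sup>2 * ennreal (pi * \<rho>\<^sup>2)) * (\<integral>\<^sup>+x. (\<phi> x)\<^sup>2 * indicator (cball y \<rho>) x \<partial>lborel)"
      using mult_left_mono[OF CS[of y] zero_le, of "?w\<^sup>2"] by (simp only: power_mult_distrib mult_ac)
  qed
  also have "\<dots> = (?w\<^sup>2 * ennreal (pi * \<rho>\<^sup>2))
      * (\<integral>\<^sup>+y. (\<integral>\<^sup>+x. (\<phi> x)\<^sup>2 * indicator (cball y \<rho>) x \<partial>lborel) \<partial>lborel)"
    by (intro nn_integral_cmult) measurable
  also have "(\<integral>\<^sup>+y. (\<integral>\<^sup>+x. (\<phi> x)\<^sup>2 * indicator (cball y \<rho>) x \<partial>lborel) \<partial>lborel)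
      = (\<integral>\<^sup>+y. 1 * (\<integral>\<^sup>+x. (\<phi> x)\<^sup>2 * indicator (cball y \<rho>) x \<partial>lborel) \<partial>lborel)"
    by simp
  also have "\<dots> = (\<integral>\<^sup>+x. (\<phi> x)\<^sup>2 * (\<integral>\<^sup>+y. 1 * indicator (cball x \<rho>) y \<partial>lborel) \<partial>lborel)"
    by (rule nn_integral_ball_swap) measurable
  also have "\<dots> = ennreal (pi * \<rho>\<^sup>2) * (\<integral>\<^sup>+x. (\<phi> x)\<^sup>2 \<partial>lborel)"
    using assms by (simp add: emeasure_disc nn_integral_multc mult.commute)
  also have "(?w\<^sup>2 * ennreal (pi * \<rho>\<^sup>2)) * (ennreal (pi * \<rho>\<^sup>2) * (\<integral>\<^sup>+x. (\<phi> x)\<^sup>2 \<partial>lborel))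
      = ennreal ((1 / \<rho>\<^sup>2)\<^sup>2 * (pi * \<rho>\<^sup>2) * (pi * \<rho>\<^sup>2)) * (\<integral>\<^sup>+x. (\<phi> x)\<^sup>2 \<partial>lborel)"
  proof -
    have "ennreal w ^ 2 * ennreal p * (ennreal p * X) = ennreal (w\<^sup>2 * p * p) * X"
      if "0 \<le> w" "0 \<le> p" for w p X
      using that by (simp add: ennreal_mult ennreal_power mult_ac)
    then show ?thesis by simp
  qed
  also have "(1 / \<rho>\<^sup>2)\<^sup>2 * (pi * \<rho>\<^sup>2) * (pi * \<rho>\<^sup>2) = pi\<^sup>2"
    using assms by (simp add: power2_eq_square field_simps)
  finally show ?thesis .
qed

text \<open>
  The adjoint of the operator that sends \<open>f\<close> to the combination, with weights \<open>\<alpha> j x\<close>, of its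
  normalised integrals over the discs of radius \<open>r j\<close> about \<open>x\<close>.
\<close>

definition ball_superposition ::
    "'j set \<Rightarrow> ('j \<Rightarrow> real^2 \<Rightarrow> ennreal) \<Rightarrow> ('j \<Rightarrow> real) \<Rightarrow> (real^2 \<Rightarrow> ennreal) \<Rightarrow> real^2 \<Rightarrow> ennreal" where
  "ball_superposition J \<alpha> r g y =
    (\<Sum>j\<in>J. ennreal (1 / (r j)\<^sup>2) * (\<integral>\<^sup>+x. (\<alpha> j x * g x) * indicator (cball y (r j)) x \<partial>lborel))"

lemma measurable_ball_superposition [measurable]:
  assumes [measurable]: "\<And>j. j \<in> J \<Longrightarrow> \<alpha> j \<in> borel_measurable lborel" "g \<in> borel_measurable lborel"
  shows "ball_superposition J \<alpha> r g \<in> borel_measurable lborel"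
  unfolding ball_superposition_def
  by (intro borel_measurable_sum borel_measurable_times_ennreal measurable_ball_integral) measurable

text \<open>
  In the expanded square keep the pairs \<open>i, j\<close> with \<open>r j \<le> r i\<close>. The intersection of the two discs
  is bounded by the area of the smaller one, which cancels its normalisation; the smaller index
  then enters only through the weight \<open>\<alpha> j\<close>, and these weights sum to at most \<open>1\<close>.
\<close>

lemma ball_superposition_square_step:
  fixes \<alpha> :: "'j \<Rightarrow> real^2 \<Rightarrow> ennreal"
  assumes fin: "finite J"
    and [measurable]: "\<And>j. j \<in> J \<Longrightarrow> \<alpha> j \<in> borel_measurable lborel"
    and [measurable]: "g \<in> borel_measurable lborel"
    and le1: "\<And>x. (\<Sum>j\<in>J. \<alpha> j x) \<le> 1"
    and r: "\<And>j. j \<in> J \<Longrightarrow> 0 < r j"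
  shows "(\<integral>\<^sup>+y. (ball_superposition J \<alpha> r g y)\<^sup>2 \<partial>lborel)
    \<le> ennreal (8 * pi) * (\<integral>\<^sup>+x. g x * ball_superposition J \<alpha> (\<lambda>j. 2 * r j) g x \<partial>lborel)"
proof -
  define W where "W j s y = (\<integral>\<^sup>+x. (\<alpha> j x * g x) * indicator (cball y s) x \<partial>lborel)" for j s y
  define U where "U j y = ennreal (1 / (r j)\<^sup>2) * W j (r j) y" for j y
  define V where "V j y = ennreal (1 / (2 * r j)\<^sup>2) * W j (2 * r j) y" for j y
  let ?L = "\<lambda>i. {j\<in>J. r j \<le> r i}"
  have W_meas [measurable]: "W j s \<in> borel_measurable lborel" if "j \<in> J" for j s
    unfolding W_def using that by (intro measurable_ball_integral) measurable
  have U_meas [measurable]: "U j \<in> borel_measurable lborel" if "j \<in> J" for j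
    unfolding U_def using that by measurable
  have V_meas [measurable]: "V j \<in> borel_measurable lborel" if "j \<in> J" for j
    unfolding V_def using that by measurable
  have pair: "(\<integral>\<^sup>+y. U i y * U j y \<partial>lborel)
      \<le> ennreal (4 * pi) * (\<integral>\<^sup>+x. \<alpha> j x * (g x * V i x) \<partial>lborel)"
    if ij: "i \<in> J" "j \<in> J" "r j \<le> r i" for i j
  proof -
    have [measurable]: "\<alpha> i \<in> borel_measurable lborel" "\<alpha> j \<in> borel_measurable lborel"
        "W i s \<in> borel_measurable lborel" "W j s \<in> borel_measurable lborel" for s
      using ij by auto
    have pos: "0 < r i" "0 < r j" using ij r by auto
    have "(\<integral>\<^sup>+y. U i y * U j y \<partial>lborel)
        = (\<integral>\<^sup>+y. ennreal (1 / (r i)\<^sup>2 * (1 / (r j)\<^sup>2)) * (W i (r i) y * W j (r j) y) \<partial>lborel)"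
      unfolding U_def by (subst ennreal_mult) (simp_all only: mult_ac, simp_all)
    also have "\<dots> = ennreal (1 / (r i)\<^sup>2 * (1 / (r j)\<^sup>2)) * (\<integral>\<^sup>+y. W i (r i) y * W j (r j) y \<partial>lborel)"
      by (intro nn_integral_cmult) measurable
    also have "\<dots> \<le> ennreal (1 / (r i)\<^sup>2 * (1 / (r j)\<^sup>2)) * (ennreal (pi * (r j)\<^sup>2)
        * (\<integral>\<^sup>+x. (\<alpha> j x * g x) * W i (2 * r i) x \<partial>lborel))"
      unfolding W_def using pos ij
      by (intro mult_left_mono nn_integral_ball_product_le) measurable
    also have "\<dots> = ennreal (1 / (r i)\<^sup>2 * (1 / (r j)\<^sup>2) * (pi * (r j)\<^sup>2))
        * (\<integral>\<^sup>+x. (\<alpha> j x * g x) * W i (2 * r i) x \<partial>lborel)"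
      by (rule ennreal_mult_assoc) auto
    also have "1 / (r i)\<^sup>2 * (1 / (r j)\<^sup>2) * (pi * (r j)\<^sup>2) = 4 * pi * (1 / (2 * r i)\<^sup>2)"
      using pos by (simp add: power2_eq_square field_simps)
    also have "ennreal (4 * pi * (1 / (2 * r i)\<^sup>2)) * (\<integral>\<^sup>+x. (\<alpha> j x * g x) * W i (2 * r i) x \<partial>lborel)
        = ennreal (4 * pi) * (ennreal (1 / (2 * r i)\<^sup>2)
          * (\<integral>\<^sup>+x. (\<alpha> j x * g x) * W i (2 * r i) x \<partial>lborel))"
      by (subst ennreal_mult) (auto simp: mult_ac)
    also have "ennreal (1 / (2 * r i)\<^sup>2) * (\<integral>\<^sup>+x. (\<alpha> j x * g x) * W i (2 * r i) x \<partial>lborel)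
        = (\<integral>\<^sup>+x. ennreal (1 / (2 * r i)\<^sup>2) * ((\<alpha> j x * g x) * W i (2 * r i) x) \<partial>lborel)"
      by (intro nn_integral_cmult[symmetric]) measurable
    also have "\<dots> = (\<integral>\<^sup>+x. \<alpha> j x * (g x * V i x) \<partial>lborel)"
      by (simp add: V_def mult_ac)
    finally show ?thesis .
  qed
  have row: "(\<Sum>j\<in>?L i. \<integral>\<^sup>+y. U i y * U j y \<partial>lborel)
      \<le> ennreal (4 * pi) * (\<integral>\<^sup>+x. g x * V i x \<partial>lborel)" if i: "i \<in> J" for i
  proof -
    have [measurable]: "V i \<in> borel_measurable lborel" using i by (rule V_meas)
    have "(\<Sum>j\<in>?L i. \<integral>\<^sup>+y. U i y * U j y \<partial>lborel)
        \<le> (\<Sum>j\<in>?L i. ennreal (4 * pi) * (\<integral>\<^sup>+x. \<alpha> j x * (g x * V i x) \<partial>lborel))"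
      using i by (intro sum_mono pair) auto
    also have "\<dots> \<le> (\<Sum>j\<in>J. ennreal (4 * pi) * (\<integral>\<^sup>+x. \<alpha> j x * (g x * V i x) \<partial>lborel))"
      using fin by (intro sum_mono2) auto
    also have "\<dots> = ennreal (4 * pi) * (\<integral>\<^sup>+x. (\<Sum>j\<in>J. \<alpha> j x * (g x * V i x)) \<partial>lborel)"
      by (subst nn_integral_sum) (measurable, simp add: sum_distrib_left)
    also have "\<dots> = ennreal (4 * pi) * (\<integral>\<^sup>+x. (\<Sum>j\<in>J. \<alpha> j x) * (g x * V i x) \<partial>lborel)"
      by (simp add: sum_distrib_right)
    also have "\<dots> \<le> ennreal (4 * pi) * (\<integral>\<^sup>+x. 1 * (g x * V i x) \<partial>lborel)"
      by (intro mult_left_mono nn_integral_mono mult_right_mono le1) auto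
    finally show ?thesis by simp
  qed
  have "(\<integral>\<^sup>+y. (ball_superposition J \<alpha> r g y)\<^sup>2 \<partial>lborel) = (\<integral>\<^sup>+y. (\<Sum>j\<in>J. U j y)\<^sup>2 \<partial>lborel)"
    by (simp add: ball_superposition_def U_def W_def)
  also have "\<dots> \<le> (\<integral>\<^sup>+y. 2 * (\<Sum>i\<in>J. \<Sum>j\<in>?L i. U i y * U j y) \<partial>lborel)"
    by (intro nn_integral_mono sum_square_le_ordered_pairs fin)
  also have "\<dots> = 2 * (\<integral>\<^sup>+y. (\<Sum>i\<in>J. \<Sum>j\<in>?L i. U i y * U j y) \<partial>lborel)"
    by (intro nn_integral_cmult) measurable
  also have "(\<integral>\<^sup>+y. (\<Sum>i\<in>J. \<Sum>j\<in>?L i. U i y * U j y) \<partial>lborel)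
      = (\<Sum>i\<in>J. \<integral>\<^sup>+y. (\<Sum>j\<in>?L i. U i y * U j y) \<partial>lborel)"
    by (rule nn_integral_sum) measurable
  also have "\<dots> = (\<Sum>i\<in>J. \<Sum>j\<in>?L i. \<integral>\<^sup>+y. U i y * U j y \<partial>lborel)"
    by (intro sum.cong refl nn_integral_sum) (auto intro!: borel_measurable_times_ennreal)
  also have "2 * \<dots> \<le> 2 * (\<Sum>i\<in>J. ennreal (4 * pi) * (\<integral>\<^sup>+x. g x * V i x \<partial>lborel))"
    by (intro mult_left_mono sum_mono row) auto
  also have "\<dots> = ennreal (8 * pi) * (\<Sum>i\<in>J. \<integral>\<^sup>+x. g x * V i x \<partial>lborel)"
  proof -
    have "ennreal (8 * pi) = ennreal (2 * (4 * pi))" by simp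
    also have "\<dots> = 2 * ennreal (4 * pi)" by (subst ennreal_mult) auto
    finally have "ennreal (8 * pi) = 2 * ennreal (4 * pi)" .
    then show ?thesis by (simp add: sum_distrib_left mult.assoc)
  qed
  also have "(\<Sum>i\<in>J. \<integral>\<^sup>+x. g x * V i x \<partial>lborel) = (\<integral>\<^sup>+x. (\<Sum>i\<in>J. g x * V i x) \<partial>lborel)"
    by (rule nn_integral_sum[symmetric]) measurable
  also have "\<dots> = (\<integral>\<^sup>+x. g x * ball_superposition J \<alpha> (\<lambda>j. 2 * r j) g x \<partial>lborel)"
    by (simp add: ball_superposition_def V_def W_def sum_distrib_left)
  finally show ?thesis .
qed

text \<open>
  The Hardy--Littlewood maximal inequality in dual form. Doubling all radii in
  \<open>ball_superposition_square_step\<close> and using the Cauchy--Schwarz inequality gives the hypothesis of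
  \<open>bounded_square_iteration\<close>; boundedness over all doublings holds because each single
  disc average is bounded on \<open>L\<^sup>2\<close> uniformly in its radius.
\<close>

theorem ball_superposition_L2_bound:
  fixes \<alpha> :: "'j \<Rightarrow> real^2 \<Rightarrow> ennreal"
  assumes fin: "finite J"
    and meas [measurable]: "\<And>j. j \<in> J \<Longrightarrow> \<alpha> j \<in> borel_measurable lborel"
    and g [measurable]: "g \<in> borel_measurable lborel"
    and le1: "\<And>x. (\<Sum>j\<in>J. \<alpha> j x) \<le> 1"
    and r: "\<And>j. j \<in> J \<Longrightarrow> 0 < r j"
  shows "(\<integral>\<^sup>+y. (ball_superposition J \<alpha> r g y)\<^sup>2 \<partial>lborel)
    \<le> ennreal ((8 * pi)\<^sup>2) * (\<integral>\<^sup>+x. (g x)\<^sup>2 \<partial>lborel)"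
proof (cases "(\<integral>\<^sup>+x. (g x)\<^sup>2 \<partial>lborel) = \<infinity>")
  case True
  then show ?thesis by (simp add: ennreal_mult_top)
next
  case False
  define P where "P = (\<integral>\<^sup>+x. (g x)\<^sup>2 \<partial>lborel)"
  define S where "S n = ball_superposition J \<alpha> (\<lambda>j. 2 ^ n * r j) g" for n :: nat
  have P: "P < \<infinity>" using False by (simp add: P_def less_top)
  have [measurable]: "S n \<in> borel_measurable lborel" for n
    unfolding S_def by measurable
  have \<alpha>1: "\<alpha> j x \<le> 1" if "j \<in> J" for j x
    using le1[of x] member_le_sum[OF that, of "\<lambda>j. \<alpha> j x"] fin by auto
  have "(\<integral>\<^sup>+y. (S 0 y)\<^sup>2 \<partial>lborel) \<le> ennreal ((8 * pi)\<^sup>2) * P"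
  proof (rule bounded_square_iteration)
    fix n
    have "(\<integral>\<^sup>+y. (S n y)\<^sup>2 \<partial>lborel) \<le> ennreal (8 * pi) * (\<integral>\<^sup>+x. g x * S (Suc n) x \<partial>lborel)"
      using ball_superposition_square_step[OF fin meas g le1, of "\<lambda>j. 2 ^ n * r j"] r
      by (simp add: S_def mult.assoc)
    then have "(\<integral>\<^sup>+y. (S n y)\<^sup>2 \<partial>lborel)\<^sup>2
        \<le> (ennreal (8 * pi) * (\<integral>\<^sup>+x. g x * S (Suc n) x \<partial>lborel))\<^sup>2"
      by (rule power_mono) simp
    also have "\<dots> = ennreal ((8 * pi)\<^sup>2) * (\<integral>\<^sup>+x. g x * S (Suc n) x \<partial>lborel)\<^sup>2"
      by (simp add: power_mult_distrib ennreal_power)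
    also have "\<dots> \<le> ennreal ((8 * pi)\<^sup>2) * (P * (\<integral>\<^sup>+y. (S (Suc n) y)\<^sup>2 \<partial>lborel))"
      unfolding P_def by (intro mult_left_mono Cauchy_Schwarz_nn_integral) auto
    finally show "(\<integral>\<^sup>+y. (S n y)\<^sup>2 \<partial>lborel)\<^sup>2
        \<le> ennreal ((8 * pi)\<^sup>2) * P * (\<integral>\<^sup>+y. (S (Suc n) y)\<^sup>2 \<partial>lborel)"
      by (simp add: mult.assoc)
  next
    fix n
    define U where "U j y = ennreal (1 / (2 ^ n * r j)\<^sup>2)
      * (\<integral>\<^sup>+x. (\<alpha> j x * g x) * indicator (cball y (2 ^ n * r j)) x \<partial>lborel)" for j y
    have U_meas [measurable]: "U j \<in> borel_measurable lborel" if "j \<in> J" for j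
      unfolding U_def using that
      by (intro borel_measurable_times_ennreal measurable_ball_integral) measurable
    have U: "(\<integral>\<^sup>+y. (U j y)\<^sup>2 \<partial>lborel) \<le> ennreal (pi\<^sup>2) * P" if j: "j \<in> J" for j
    proof -
      have "(\<integral>\<^sup>+y. (U j y)\<^sup>2 \<partial>lborel) \<le> ennreal (pi\<^sup>2) * (\<integral>\<^sup>+x. (\<alpha> j x * g x)\<^sup>2 \<partial>lborel)"
        unfolding U_def using r[OF j] meas[OF j]
        by (intro nn_integral_ball_average_square_le) auto
      also have "\<dots> \<le> ennreal (pi\<^sup>2) * P"
        unfolding P_def
        using \<alpha>1[OF j] mult_right_mono[of "\<alpha> j _" 1 "g _"]
        by (intro mult_left_mono nn_integral_mono power_mono) auto
      finally show ?thesis .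
    qed
    have "(\<integral>\<^sup>+y. (S n y)\<^sup>2 \<partial>lborel)
        \<le> (\<integral>\<^sup>+y. 2 * of_nat (card J) * (\<Sum>j\<in>J. (U j y)\<^sup>2) \<partial>lborel)"
      unfolding S_def ball_superposition_def U_def by (intro nn_integral_mono sum_square_le_card)
    also have "\<dots> = 2 * of_nat (card J) * (\<Sum>j\<in>J. \<integral>\<^sup>+y. (U j y)\<^sup>2 \<partial>lborel)"
      by (subst nn_integral_cmult) (measurable, subst nn_integral_sum, measurable)
    also have "\<dots> \<le> 2 * of_nat (card J) * (\<Sum>j\<in>J. ennreal (pi\<^sup>2) * P)"
      by (intro mult_left_mono sum_mono U) auto
    finally show "(\<integral>\<^sup>+y. (S n y)\<^sup>2 \<partial>lborel) \<le> 2 * of_nat (card J) * (\<Sum>j\<in>J. ennreal (pi\<^sup>2) * P)" .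
  next
    show "2 * of_nat (card J) * (\<Sum>j\<in>J. ennreal (pi\<^sup>2) * P) < \<infinity>"
      using P by (simp add: ennreal_mult_less_top of_nat_less_top)
  qed
  then show ?thesis by (simp add: S_def P_def)
qed

section \<open>Intersections of rectangles\<close>

lemma inner_real2: "(x :: real^2) \<bullet> y = x$1 * y$1 + x$2 * y$2"
  by (simp add: inner_vec_def sum_2)

definition cross2 :: "real^2 \<Rightarrow> real^2 \<Rightarrow> real" where
  "cross2 a b = a$1 * b$2 - a$2 * b$1"

text \<open>
  The region is a parallelogram: the coordinates \<open>y \<bullet> a\<close> and \<open>y \<bullet> b\<close> map it onto a box, and this
  linear map has determinant \<open>cross2 a b\<close>. All areas of rectangles and of their intersections below
  are computed or bounded by this formula.
\<close>

lemma emeasure_slab_Int: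
  fixes a b c d :: "real^2"
  assumes nz: "cross2 a b \<noteq> 0" and "0 \<le> s" "0 \<le> t"
  shows "emeasure lborel {y. \<bar>(y - c) \<bullet> a\<bar> \<le> s \<and> \<bar>(y - d) \<bullet> b\<bar> \<le> t}
    = ennreal (4 * s * t / \<bar>cross2 a b\<bar>)"
proof -
  let ?S = "{y. \<bar>(y - c) \<bullet> a\<bar> \<le> s \<and> \<bar>(y - d) \<bullet> b\<bar> \<le> t}"
  let ?\<Delta> = "cross2 a b"
  define M :: "real^2 \<Rightarrow> real^2"
    where "M z = vector [(b$2 * z$1 - a$2 * z$2) / ?\<Delta>, (a$1 * z$2 - b$1 * z$1) / ?\<Delta>]" for z
  define l r :: "real^2" where "l = vector [c \<bullet> a - s, d \<bullet> b - t]" and "r = vector [c \<bullet> a + s, d \<bullet> b + t]"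
  have lin: "linear M"
    by (rule linearI) (simp_all add: M_def vec_eq_iff forall_2 vector_2 algebra_simps add_divide_distrib diff_divide_distrib)
  have M1: "M z \<bullet> a = z$1" "M z \<bullet> b = z$2" for z
    using nz by (simp_all add: M_def inner_real2 vector_2 field_simps) (simp_all add: cross2_def algebra_simps)
  have M2: "M (vector [y \<bullet> a, y \<bullet> b]) = y" for y
    using nz by (simp add: M_def inner_real2 vector_2 vec_eq_iff forall_2 field_simps)
      (simp add: cross2_def algebra_simps)
  have mem: "M z \<in> ?S \<longleftrightarrow> z \<in> cbox l r" for z
    by (auto simp: mem_box_cart forall_2 l_def r_def vector_2 inner_diff_left M1 abs_le_iff)
  have S: "?S = M ` cbox l r"
  proof (intro equalityI subsetI)
    fix y assume "y \<in> ?S"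
    then show "y \<in> M ` cbox l r" using M2[of y] mem[of "vector [y \<bullet> a, y \<bullet> b]"]
      by (metis (no_types, lifting) imageI)
  next
    fix y assume "y \<in> M ` cbox l r"
    then show "y \<in> ?S" using mem by blast
  qed
  have det: "det (matrix M) = 1 / ?\<Delta>"
    using nz by (simp add: det_2 matrix_def M_def vector_2 axis_def field_simps)
      (simp add: cross2_def algebra_simps)
  have meas: "?S \<in> lmeasurable" and "measure lebesgue ?S = \<bar>det (matrix M)\<bar> * measure lebesgue (cbox l r)"
    unfolding S by (rule measurable_linear_image[OF lin] measure_linear_image[OF lin]; simp)+
  then have "measure lebesgue ?S = \<bar>1 / ?\<Delta>\<bar> * measure lebesgue (cbox l r)"
    by (simp add: det)
  also have "measure lebesgue (cbox l r) = measure lborel (cbox l r)" by simp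
  also have "\<dots> = (2 * s) * (2 * t)"
  proof (subst content_cbox_cart)
    have "l \<in> cbox l r" using assms by (simp add: mem_box_cart forall_2 l_def r_def vector_2)
    then show "cbox l r \<noteq> {}" by auto
  qed (simp add: l_def r_def UNIV_2 vector_2)
  finally have "measure lebesgue ?S = 4 * s * t / \<bar>?\<Delta>\<bar>" by simp
  moreover have "emeasure lebesgue ?S = ennreal (measure lebesgue ?S)"
    using meas by (rule emeasure_eq_measure2)
  moreover have "closed ?S"
    by (intro closed_Collect_conj closed_Collect_le continuous_intros)
  then have "emeasure lebesgue ?S = emeasure lborel ?S" by (simp add: borel_closed)
  ultimately show ?thesis by simp
qed

definition orthonormal :: "real^2 \<Rightarrow> real^2 \<Rightarrow> bool" where
  "orthonormal u v \<longleftrightarrow> norm u = 1 \<and> norm v = 1 \<and> u \<bullet> v = 0"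

lemma orthonormal_coords:
  assumes "orthonormal u v"
  shows "u$1 * u$1 + u$2 * u$2 = 1" "v$1 * v$1 + v$2 * v$2 = 1" "u$1 * v$1 + u$2 * v$2 = 0"
  using assms by (auto simp: orthonormal_def norm_eq_1 inner_real2)

lemma orthonormal_cross2:
  assumes "orthonormal u v"
  shows "\<bar>cross2 u v\<bar> = 1"
proof -
  have "(cross2 u v)\<^sup>2 = (u$1 * u$1 + u$2 * u$2) * (v$1 * v$1 + v$2 * v$2) - (u$1 * v$1 + u$2 * v$2)\<^sup>2"
    by (simp add: cross2_def power2_eq_square algebra_simps)
  also have "\<dots> = 1" by (simp add: orthonormal_coords[OF assms])
  finally show ?thesis by (auto simp: power2_eq_1_iff)
qed

lemma orthonormal_expand:
  assumes "orthonormal u v"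
  shows "z = (z \<bullet> u) *\<^sub>R u + (z \<bullet> v) *\<^sub>R v"
proof -
  have nz: "cross2 u v \<noteq> 0" using orthonormal_cross2[OF assms] by auto
  let ?d = "z - ((z \<bullet> u) *\<^sub>R u + (z \<bullet> v) *\<^sub>R v)"
  have "u \<bullet> u = 1" "v \<bullet> v = 1" "u \<bullet> v = 0" "v \<bullet> u = 0"
    using assms by (auto simp: orthonormal_def norm_eq_1 inner_commute)
  then have *: "?d \<bullet> u = 0" "?d \<bullet> v = 0"
    by (simp_all add: inner_diff_left inner_add_left)
  define d where "d = ?d"
  have e: "d$1 * u$1 + d$2 * u$2 = 0" "d$1 * v$1 + d$2 * v$2 = 0"
    using *[folded d_def] by (simp_all only: inner_real2)
  have q: "d$1 * cross2 u v = (d$1 * u$1 + d$2 * u$2) * v$2 - (d$1 * v$1 + d$2 * v$2) * u$2"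
       "d$2 * cross2 u v = (d$1 * v$1 + d$2 * v$2) * u$1 - (d$1 * u$1 + d$2 * u$2) * v$1"
    by (simp_all add: cross2_def algebra_simps)
  then have "d = 0" using q[unfolded e] nz by (simp add: vec_eq_iff forall_2)
  then show ?thesis by (simp add: d_def)
qed

lemma norm_le_orthonormal:
  assumes "orthonormal u v"
  shows "norm z \<le> \<bar>z \<bullet> u\<bar> + \<bar>z \<bullet> v\<bar>"
proof -
  have "norm z = norm ((z \<bullet> u) *\<^sub>R u + (z \<bullet> v) *\<^sub>R v)"
    using orthonormal_expand[OF assms] by metis
  also have "\<dots> \<le> norm ((z \<bullet> u) *\<^sub>R u) + norm ((z \<bullet> v) *\<^sub>R v)" by (rule norm_triangle_ineq)
  finally show ?thesis using assms by (simp add: orthonormal_def)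
qed

text \<open>
  The rectangle with centre \<open>c\<close> and half-sides \<open>a\<close> along \<open>u\<close> and \<open>b\<close> along \<open>v\<close>. Centred rectangles
  are used since dilation about the centre only rescales \<open>a\<close> and \<open>b\<close>.
\<close>

definition crect :: "real^2 \<Rightarrow> real^2 \<Rightarrow> real^2 \<Rightarrow> real \<Rightarrow> real \<Rightarrow> (real^2) set" where
  "crect c u v a b = {y. \<bar>(y - c) \<bullet> u\<bar> \<le> a \<and> \<bar>(y - c) \<bullet> v\<bar> \<le> b}"

lemma closed_crect: "closed (crect c u v a b)"
  unfolding crect_def by (intro closed_Collect_conj closed_Collect_le continuous_intros)

lemma sets_crect [measurable, simp]: "crect c u v a b \<in> sets borel"
  using closed_crect by (rule borel_closed)

lemma emeasure_crect:
  assumes "orthonormal u v" "0 \<le> a" "0 \<le> b"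
  shows "emeasure lborel (crect c u v a b) = ennreal (4 * a * b)"
  using emeasure_slab_Int[of u v a b c c] orthonormal_cross2[OF assms(1)] assms
  by (auto simp: crect_def)

lemma crect_mono: "a \<le> a' \<Longrightarrow> b \<le> b' \<Longrightarrow> crect c u v a b \<subseteq> crect c u v a' b'"
  by (auto simp: crect_def)

lemma ex_dyadic_scale:
  fixes b D :: real
  assumes "0 < b" "0 \<le> D"
  obtains d where "2 * D \<le> 2 ^ d * b" "2 ^ d * b \<le> max b (4 * D)"
proof (cases "2 * D \<le> b")
  case True
  with that[of 0] show ?thesis by simp
next
  case False
  let ?P = "\<lambda>d. 2 * D \<le> 2 ^ d * b"
  obtain n where "2 * D / b < 2 ^ n" using real_arch_pow[of 2] by auto
  then have "?P n" using assms by (simp add: divide_less_eq)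
  define d where "d = (LEAST d. ?P d)"
  have d: "?P d" unfolding d_def by (rule LeastI[of ?P, OF \<open>?P n\<close>])
  then have "d \<noteq> 0" using False by (intro notI) simp
  then obtain m where m: "d = Suc m" by (cases d) auto
  have "\<not> ?P m" using not_less_Least[of m ?P] m by (simp add: d_def)
  moreover have "2 ^ d * b = 2 * (2 ^ m * b)" by (simp add: m)
  ultimately have "2 ^ d * b \<le> 4 * D" by linarith
  with d that show ?thesis by fastforce
qed

text \<open>
  For a unit vector \<open>w\<close>, both sides are the sine of the angle between \<open>v\<close> and \<open>w\<close>.
\<close>

lemma cross2_orthonormal_abs:
  assumes "orthonormal u v"
  shows "\<bar>cross2 v w\<bar> = \<bar>u \<bullet> w\<bar>"
proof -
  have "cross2 v w = cross2 v ((w \<bullet> u) *\<^sub>R u + (w \<bullet> v) *\<^sub>R v)"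
    using orthonormal_expand[OF assms, of w] by simp
  also have "\<dots> = - (w \<bullet> u) * cross2 u v"
    by (simp add: cross2_def algebra_simps)
  finally show ?thesis using orthonormal_cross2[OF assms] by (simp add: abs_mult inner_commute)
qed

text \<open>
  Write \<open>R\<close> for the longer and \<open>R'\<close> for the shorter rectangle, and let \<open>D\<close> be the distance of \<open>x\<close>
  from a point of \<open>R \<inter> R'\<close>, measured across \<open>R\<close>. A disc about \<open>x\<close> whose radius \<open>r\<close> lies
  between \<open>2 * D\<close> and \<open>16 * a'\<close> meets the dilate of \<open>R\<close> in area at least comparable to \<open>r * min b r\<close>. (The dilate rather
  than \<open>R\<close> itself is needed since \<open>x\<close> may lie beyond the short end of \<open>R\<close>.) On the other hand, if
  \<open>D\<close> is much larger than \<open>b'\<close>, then \<open>R'\<close> is tilted against \<open>R\<close> by an angle of sine at least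
  comparable to \<open>D / a'\<close>, so \<open>R \<inter> R'\<close> has area at most comparable to \<open>a' * b' * b / D\<close>. Thus \<open>r\<close>
  comparable to the maximum of \<open>D\<close> and \<open>b'\<close> balances both sides.
\<close>

lemma crect_Int_measure_le:
  assumes o: "orthonormal u v" and o': "orthonormal u' v'"
    and a: "0 < b" "0 < b'" "b' \<le> a'" "a' \<le> a"
    and z: "z \<in> crect c u v a b" "z \<in> crect c' u' v' a' b'"
    and x: "x \<in> crect c' u' v' a' b'"
  obtains d where "2 ^ d * b' \<le> 16 * a'"
    "emeasure lborel (crect c u v a b \<inter> crect c' u' v' a' b') * ennreal ((2 ^ d * b')\<^sup>2)
      \<le> ennreal (4096 * a' * b') * emeasure lborel (crect c u v (6 * a) (6 * b) \<inter> cball x (2 ^ d * b'))"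
proof -
  let ?R = "crect c u v a b" and ?R' = "crect c' u' v' a' b'"
  define D where "D = \<bar>(x - z) \<bullet> v\<bar>"
  have xz: "\<bar>(x - z) \<bullet> u'\<bar> \<le> 2 * a'" "\<bar>(x - z) \<bullet> v'\<bar> \<le> 2 * b'"
    using z x by (auto simp: crect_def inner_diff_left abs_le_iff)
  have diam: "\<bar>(y - z) \<bullet> w\<bar> \<le> 4 * a'" if "y \<in> ?R'" "norm w = 1" for y w
  proof -
    have "\<bar>(y - z) \<bullet> w\<bar> \<le> norm (y - z)"
      using Cauchy_Schwarz_ineq2[of "y - z" w] that by simp
    also have "\<dots> \<le> \<bar>(y - z) \<bullet> u'\<bar> + \<bar>(y - z) \<bullet> v'\<bar>" by (rule norm_le_orthonormal[OF o'])
    also have "\<dots> \<le> 2 * a' + 2 * b'"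
      using z that by (intro add_mono) (auto simp: crect_def inner_diff_left abs_le_iff)
    finally show ?thesis using a by simp
  qed
  have nu: "norm u = 1" "norm v = 1" using o by (auto simp: orthonormal_def)
  have D: "0 \<le> D" "D \<le> 4 * a'" using diam[OF x nu(2)] by (auto simp: D_def)
  obtain d where d: "2 * D \<le> 2 ^ d * b'" "2 ^ d * b' \<le> max b' (4 * D)"
    using ex_dyadic_scale[of b' D] a D by auto
  define r where "r = 2 ^ d * b'"
  have r: "2 * D \<le> r" "r \<le> max b' (4 * D)" "b' \<le> r" "0 < r"
    using d a by (auto simp: r_def)
  have r16: "r \<le> 16 * a'" using r D a by auto
  define m where "m = min b r"
  have m: "0 < m" "m \<le> b" "m \<le> r" using r a by (auto simp: m_def)
  have lower: "ennreal (r * m / 16) \<le> emeasure lborel (crect c u v (6 * a) (6 * b) \<inter> cball x r)"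
  proof -
    \<comment> \<open>The box sits level with \<open>x\<close> along \<open>u\<close>, where the dilate of \<open>R\<close> reaches, and level with \<open>z\<close>
        along \<open>v\<close>, inside the strip carrying \<open>R\<close>.\<close>
    let ?B = "{y. \<bar>(y - x) \<bullet> u\<bar> \<le> r / 16 \<and> \<bar>(y - z) \<bullet> v\<bar> \<le> m / 4}"
    have "?B \<subseteq> crect c u v (6 * a) (6 * b) \<inter> cball x r"
    proof
      fix y assume y: "y \<in> ?B"
      have "(y - c) \<bullet> u = (y - x) \<bullet> u + (x - z) \<bullet> u + (z - c) \<bullet> u"
        by (simp add: inner_diff_left)
      moreover have "\<bar>(z - c) \<bullet> u\<bar> \<le> a" using z by (simp add: crect_def)
      ultimately have 1: "\<bar>(y - c) \<bullet> u\<bar> \<le> 6 * a"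
        using y diam[OF x nu(1)] r16 a by auto
      have "(y - c) \<bullet> v = (y - z) \<bullet> v + (z - c) \<bullet> v"
        by (simp add: inner_diff_left)
      moreover have "\<bar>(z - c) \<bullet> v\<bar> \<le> b" using z by (simp add: crect_def)
      ultimately have 2: "\<bar>(y - c) \<bullet> v\<bar> \<le> 6 * b" using y m by auto
      have "(y - x) \<bullet> v = (y - z) \<bullet> v - (x - z) \<bullet> v" by (simp add: inner_diff_left)
      then have "\<bar>(y - x) \<bullet> v\<bar> \<le> m / 4 + D" using y by (auto simp: D_def)
      then have "norm (y - x) \<le> r"
        using norm_le_orthonormal[OF o, of "y - x"] y r m by auto
      then show "y \<in> crect c u v (6 * a) (6 * b) \<inter> cball x r"
        using 1 2 by (simp add: crect_def dist_norm norm_minus_commute)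
    qed
    moreover have "emeasure lborel ?B = ennreal (4 * (r / 16) * (m / 4))"
      using emeasure_slab_Int[of u v "r / 16" "m / 4" x z] orthonormal_cross2[OF o] r m by auto
    ultimately show ?thesis
      using emeasure_mono[of ?B "crect c u v (6 * a) (6 * b) \<inter> cball x r" lborel] by simp
  qed
  have upper: "emeasure lborel (?R \<inter> ?R') \<le> ennreal (256 * a' * b' * m / r)"
  proof (cases "r \<le> b")
    case True
    have "emeasure lborel (?R \<inter> ?R') \<le> emeasure lborel ?R'" by (intro emeasure_mono) auto
    also have "\<dots> = ennreal (4 * a' * b')" using o' a by (simp add: emeasure_crect)
    also have "\<dots> \<le> ennreal (256 * a' * b' * m / r)"
      using True r a by (intro ennreal_leI) (simp add: m_def min_def)
    finally show ?thesis .
  next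
    case False
    then have mb: "m = b" by (simp add: m_def)
    show ?thesis
    proof (cases "D < 4 * b'")
      case True
      \<comment> \<open>Here the disc is about as wide as \<open>R'\<close>, and the inclusion of \<open>R \<inter> R'\<close> in a piece of \<open>R\<close> of
          length the diameter of \<open>R'\<close> is enough.\<close>
      then have r16': "r \<le> 16 * b'" using r a by auto
      let ?B = "{y. \<bar>(y - z) \<bullet> u\<bar> \<le> 4 * a' \<and> \<bar>(y - c) \<bullet> v\<bar> \<le> b}"
      have "emeasure lborel (?R \<inter> ?R') \<le> emeasure lborel ?B"
        using diam nu by (intro emeasure_mono borel_closed)
          (auto simp: crect_def intro!: closed_Collect_conj closed_Collect_le continuous_intros)
      also have "\<dots> = ennreal (16 * a' * b)"
        using emeasure_slab_Int[of u v "4 * a'" b z c] orthonormal_cross2[OF o] a by auto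
      also have "\<dots> \<le> ennreal (256 * a' * b' * m / r)"
        using r16' r a mb by (intro ennreal_leI) (simp add: field_simps)
      finally show ?thesis .
    next
      case False
      \<comment> \<open>The sine of the angle between the long sides; \<open>x\<close> and \<open>z\<close> both lie in \<open>R'\<close>, which is too thin
          to produce the distance \<open>D\<close> unless this angle is large.\<close>
      define s where "s = \<bar>u' \<bullet> v\<bar>"
      have "x - z = ((x - z) \<bullet> u') *\<^sub>R u' + ((x - z) \<bullet> v') *\<^sub>R v'"
        by (rule orthonormal_expand[OF o'])
      then have "(x - z) \<bullet> v = ((x - z) \<bullet> u') * (u' \<bullet> v) + ((x - z) \<bullet> v') * (v' \<bullet> v)"
        by (metis inner_add_left inner_scaleR_left)
      then have "D \<le> \<bar>(x - z) \<bullet> u'\<bar> * s + \<bar>(x - z) \<bullet> v'\<bar> * \<bar>v' \<bullet> v\<bar>"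
        unfolding D_def s_def by (metis abs_mult abs_triangle_ineq)
      also have "\<dots> \<le> (2 * a') * s + (2 * b') * 1"
      proof (intro add_mono mult_mono xz)
        show "\<bar>v' \<bullet> v\<bar> \<le> 1"
          using Cauchy_Schwarz_ineq2[of v' v] o o' by (simp add: orthonormal_def)
      qed (use a in \<open>auto simp: s_def\<close>)
      finally have Ds: "D \<le> 4 * a' * s" using False by linarith
      have Dpos: "0 < D" using False a by linarith
      have "0 < s"
      proof (rule ccontr)
        assume "\<not> 0 < s"
        then have "s = 0" by (simp add: s_def)
        with Ds Dpos show False by simp
      qed
      have s: "\<bar>cross2 v' v\<bar> = s"
        using cross2_orthonormal_abs[OF o', of v] by (simp add: s_def)
      let ?B = "{y. \<bar>(y - c') \<bullet> v'\<bar> \<le> b' \<and> \<bar>(y - c) \<bullet> v\<bar> \<le> b}"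
      have "emeasure lborel (?R \<inter> ?R') \<le> emeasure lborel ?B"
        by (intro emeasure_mono borel_closed)
          (auto simp: crect_def intro!: closed_Collect_conj closed_Collect_le continuous_intros)
      also have "\<dots> = ennreal (4 * b' * b / s)"
        using emeasure_slab_Int[of v' v b' b c' c] s \<open>0 < s\<close> a by auto
      also have "\<dots> \<le> ennreal (256 * a' * b' * m / r)"
      proof (intro ennreal_leI)
        have "r \<le> 4 * D" using r False a by auto
        then have "r \<le> 16 * a' * s" using Ds by linarith
        then have "(4 * b' * b) * r \<le> (4 * b' * b) * (16 * a' * s)"
          using a by (intro mult_left_mono) auto
        also have "\<dots> \<le> 256 * a' * b' * m * s"
          using a \<open>0 < s\<close> by (simp add: mb)
        finally show "4 * b' * b / s \<le> 256 * a' * b' * m / r"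
          using \<open>0 < s\<close> r by (simp add: divide_le_eq pos_le_divide_eq)
      qed
      finally show ?thesis .
    qed
  qed
  have "emeasure lborel (?R \<inter> ?R') * ennreal (r\<^sup>2) \<le> ennreal (256 * a' * b' * m / r) * ennreal (r\<^sup>2)"
    using upper by (rule mult_right_mono) simp
  also have "\<dots> = ennreal (4096 * a' * b') * ennreal (r * m / 16)"
    using r m a by (simp add: power2_eq_square flip: ennreal_mult)
  also have "\<dots> \<le> ennreal (4096 * a' * b') * emeasure lborel (crect c u v (6 * a) (6 * b) \<inter> cball x r)"
    by (rule mult_left_mono[OF lower]) simp
  finally show ?thesis using that[of d] r16 by (simp add: r_def)
qed

section \<open>The adjoint of a linearised maximal operator\<close>

text \<open>
  A finite family of rectangles with half-sides \<open>a i\<close> and \<open>\<delta> i * a i\<close>. The pairwise disjoint sets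
  \<open>E i\<close> linearise the maximal operator: the \<open>i\<close>-th rectangle serves the points of \<open>E i\<close>, all of
  which it contains. For functions attached to the family below, \<open>s\<close> is a dilation factor.
\<close>

locale rectangle_selection =
  fixes I :: "'i set" and c u v :: "'i \<Rightarrow> real^2" and a \<delta> :: "'i \<Rightarrow> real"
    and E :: "'i \<Rightarrow> (real^2) set"
  assumes finite_I: "finite I"
    and orthonormal: "i \<in> I \<Longrightarrow> orthonormal (u i) (v i)"
    and a_pos: "i \<in> I \<Longrightarrow> 0 < a i"
    and \<delta>_range: "i \<in> I \<Longrightarrow> 0 < \<delta> i \<and> \<delta> i < 1/2"
    and E_sets: "i \<in> I \<Longrightarrow> E i \<in> sets borel"
    and E_subset: "i \<in> I \<Longrightarrow> E i \<subseteq> crect (c i) (u i) (v i) (a i) (\<delta> i * a i)"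
    and E_disjoint: "i \<in> I \<Longrightarrow> j \<in> I \<Longrightarrow> x \<in> E i \<Longrightarrow> x \<in> E j \<Longrightarrow> i = j"
begin

definition R :: "real \<Rightarrow> 'i \<Rightarrow> (real^2) set" where
  "R s i = crect (c i) (u i) (v i) (s * a i) (s * (\<delta> i * a i))"

definition \<kappa> :: "'i \<Rightarrow> real" where
  "\<kappa> i = 1 / \<bar>ln (\<delta> i)\<bar>"

definition mass :: "(real^2 \<Rightarrow> ennreal) \<Rightarrow> 'i \<Rightarrow> ennreal" where
  "mass g i = (\<integral>\<^sup>+x. indicator (E i) x * g x \<partial>lborel)"

text \<open>
  The weight of the maximal operator divided by the area of the dilated rectangle.
\<close>

definition weight :: "real \<Rightarrow> 'i \<Rightarrow> real" where
  "weight s i = \<kappa> i / (4 * s\<^sup>2 * (\<delta> i * (a i)\<^sup>2))"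

text \<open>
  For \<open>s = 1\<close> this is the adjoint of the linearised maximal operator. Under dilation the sets \<open>E i\<close>
  stay fixed and only the rectangles grow.
\<close>

definition adjoint :: "(real^2 \<Rightarrow> ennreal) \<Rightarrow> real \<Rightarrow> real^2 \<Rightarrow> ennreal" where
  "adjoint g s y = (\<Sum>i\<in>I. ennreal (weight s i) * mass g i * indicator (R s i) y)"

text \<open>
  The exponents \<open>d\<close> for which \<open>2 ^ d * (s * (\<delta> i * a i))\<close> can occur as the radius in
  \<open>crect_Int_measure_le\<close> when the \<open>i\<close>-th rectangle is the shorter one; the condition does not
  involve \<open>s\<close>.
\<close>

definition scales :: "'i \<Rightarrow> nat set" where
  "scales i = {d. 2 ^ d \<le> 16 / \<delta> i}"

definition share :: "'i \<times> nat \<Rightarrow> real^2 \<Rightarrow> ennreal" where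
  "share = (\<lambda>(i, d) x. ennreal (\<kappa> i / 9) * indicator (E i) x)"

definition radius :: "real \<Rightarrow> 'i \<times> nat \<Rightarrow> real" where
  "radius s = (\<lambda>(i, d). 2 ^ d * (s * (\<delta> i * a i)))"

text \<open>
  The superposition of disc averages that dominates the shorter rectangle of each pair. Its
  weights sum to at most \<open>1\<close> because the number of scales is at most \<open>9 / \<kappa> i\<close>.
\<close>

definition majorant :: "(real^2 \<Rightarrow> ennreal) \<Rightarrow> real \<Rightarrow> real^2 \<Rightarrow> ennreal" where
  "majorant g s = ball_superposition (SIGMA i:I. scales i) share (radius s) g"

lemma \<kappa>_pos: "i \<in> I \<Longrightarrow> 0 < \<kappa> i"
  using \<delta>_range[of i] by (simp add: \<kappa>_def)

lemma weight_nonneg: "i \<in> I \<Longrightarrow> 0 \<le> weight s i"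
  using \<delta>_range[of i] \<kappa>_pos[of i] by (simp add: weight_def)

text \<open>
  There are about \<open>log 2 (16 / \<delta> i)\<close> scales, that is, a multiple of \<open>1 / \<kappa> i\<close> of them. This is the
  point at which the logarithmic weight of the maximal operator is used.
\<close>

lemma card_scales:
  assumes i: "i \<in> I"
  shows "finite (scales i)" "\<kappa> i / 9 * card (scales i) \<le> 1"
proof -
  define L where "L = - ln (\<delta> i)"
  have \<delta>: "0 < \<delta> i" "\<delta> i < 1/2" using \<delta>_range[OF i] by auto
  have "ln (\<delta> i) \<le> ln (1/2)" using \<delta> by simp
  then have L2: "ln 2 \<le> L" by (simp add: L_def ln_div)
  have l2: "2/3 \<le> ln (2::real)" by (rule ln2_ge_two_thirds)
  have \<kappa>: "\<kappa> i = 1 / L" using L2 l2 by (simp add: \<kappa>_def L_def abs_if)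
  have bound: "real d \<le> 4 + L / ln 2" if "d \<in> scales i" for d
  proof -
    have "ln (2 ^ d :: real) \<le> ln (16 / \<delta> i)"
      using that \<delta> by (subst ln_le_cancel_iff) (auto simp: scales_def)
    also have "\<dots> = 4 * ln 2 + L"
      using \<delta> ln_realpow[of 2 4] by (simp add: ln_div L_def)
    finally have "real d * ln 2 \<le> 4 * ln 2 + L" by (simp add: ln_realpow)
    then show ?thesis using l2 by (simp add: field_simps)
  qed
  define n where "n = nat \<lfloor>4 + L / ln 2\<rfloor>"
  have sub: "scales i \<subseteq> {..n}"
  proof
    fix d assume "d \<in> scales i"
    then have "d \<le> n" unfolding n_def by (intro le_nat_floor bound)
    then show "d \<in> {..n}" by simp
  qed
  then show "finite (scales i)" by (rule finite_subset) simp
  have "real (card (scales i)) \<le> real (Suc n)"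
    using card_mono[OF _ sub] by simp
  also have "\<dots> \<le> 5 + L / ln 2"
    using L2 l2 by (simp add: n_def)
  also have "\<dots> \<le> 9 * L"
  proof -
    have "L / ln 2 \<le> 3 / 2 * L" using l2 L2 by (simp add: field_simps)
    then show ?thesis using l2 L2 by linarith
  qed
  finally show "\<kappa> i / 9 * card (scales i) \<le> 1"
    using L2 l2 by (simp add: \<kappa> field_simps)
qed

lemma share_measurable: "p \<in> (SIGMA i:I. scales i) \<Longrightarrow> share p \<in> borel_measurable lborel"
  using E_sets by (auto simp: share_def intro!: borel_measurable_times_ennreal borel_measurable_indicator)

lemma finite_pairs: "finite (SIGMA i:I. scales i)"
  using finite_I card_scales by auto

lemma share_sum: "(\<Sum>p\<in>(SIGMA i:I. scales i). share p x) \<le> 1"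
proof -
  have "(\<Sum>p\<in>(SIGMA i:I. scales i). share p x)
      = (\<Sum>i\<in>I. \<Sum>d\<in>scales i. ennreal (\<kappa> i / 9) * indicator (E i) x)"
    using finite_I card_scales by (subst sum.Sigma) (auto simp: share_def intro!: sum.cong)
  also have "\<dots> \<le> (\<Sum>i\<in>I. indicator (E i) x)"
  proof (rule sum_mono)
    fix i assume i: "i \<in> I"
    have "(\<Sum>d\<in>scales i. ennreal (\<kappa> i / 9) * indicator (E i) x)
        = ennreal (real (card (scales i)) * (\<kappa> i / 9)) * indicator (E i) x"
      using \<kappa>_pos[OF i] by (simp add: ennreal_mult_assoc ennreal_of_nat_eq_real_of_nat)
    also have "\<dots> \<le> 1 * indicator (E i) x"
      using card_scales(2)[OF i] by (intro mult_right_mono) (auto simp: mult.commute)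
    finally show "(\<Sum>d\<in>scales i. ennreal (\<kappa> i / 9) * indicator (E i) x) \<le> indicator (E i) x" by simp
  qed
  also have "\<dots> \<le> 1"
  proof (cases "\<exists>i\<in>I. x \<in> E i")
    case True
    then obtain i where i: "i \<in> I" "x \<in> E i" by auto
    then have "(\<Sum>j\<in>I. indicator (E j) x) = (\<Sum>j\<in>I. if j = i then 1 else 0 :: ennreal)"
      using E_disjoint by (intro sum.cong) (auto simp: indicator_def)
    then show ?thesis using finite_I i by simp
  next
    case False
    then show ?thesis by (simp add: indicator_def)
  qed
  finally show ?thesis .
qed

lemma radius_pos: "0 < s \<Longrightarrow> p \<in> (SIGMA i:I. scales i) \<Longrightarrow> 0 < radius s p"
  using \<delta>_range a_pos by (auto simp: radius_def)

lemma majorant_measurable: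
  "g \<in> borel_measurable lborel \<Longrightarrow> majorant g s \<in> borel_measurable lborel"
  unfolding majorant_def by (intro measurable_ball_superposition share_measurable)

lemma majorant_bound:
  assumes "g \<in> borel_measurable lborel" "0 < s"
  shows "(\<integral>\<^sup>+y. (majorant g s y)\<^sup>2 \<partial>lborel) \<le> ennreal ((8 * pi)\<^sup>2) * (\<integral>\<^sup>+x. (g x)\<^sup>2 \<partial>lborel)"
  unfolding majorant_def using assms
  by (intro ball_superposition_L2_bound finite_pairs share_measurable share_sum radius_pos)

lemma R_sets [measurable, simp]: "R s i \<in> sets borel"
  by (simp add: R_def)

lemma emeasure_R:
  "i \<in> I \<Longrightarrow> 0 \<le> s \<Longrightarrow> emeasure lborel (R s i) = ennreal (4 * s\<^sup>2 * (\<delta> i * (a i)\<^sup>2))"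
  unfolding R_def using \<delta>_range[of i] a_pos[of i] orthonormal[of i]
  by (subst emeasure_crect) (auto simp: power2_eq_square mult_ac)

lemma adjoint_measurable [measurable]: "adjoint g s \<in> borel_measurable lborel"
  unfolding adjoint_def by measurable

text \<open>
  One scale suffices by \<open>crect_Int_measure_le\<close>, but it depends on \<open>i\<close>, \<open>j\<close> and \<open>x\<close>. Summing over all
  scales removes this dependence.
\<close>

lemma R_Int_measure_le:
  assumes i: "i \<in> I" and j: "j \<in> I" and le: "a j \<le> a i" and s: "1 \<le> s" and x: "x \<in> E j"
  shows "ennreal (weight s j) * emeasure lborel (R s i \<inter> R s j)
    \<le> ennreal 1024 * (\<Sum>d\<in>scales j. ennreal (1 / (radius s (j, d))\<^sup>2) * (ennreal (\<kappa> j)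
        * emeasure lborel (R (6 * s) i \<inter> cball x (radius s (j, d)))))"
proof (cases "R s i \<inter> R s j = {}")
  case True
  then show ?thesis by simp
next
  case False
  then obtain z where z: "z \<in> R s i" "z \<in> R s j" by auto
  have pos: "0 < a i" "0 < a j" "0 < \<delta> i" "0 < \<delta> j" "\<delta> j < 1/2" "0 < \<kappa> j"
    using a_pos \<delta>_range \<kappa>_pos i j by auto
  have "x \<in> R 1 j" using x E_subset[OF j] by (auto simp: R_def)
  then have xR: "x \<in> R s j"
    using s pos crect_mono[of "a j" "s * a j" "\<delta> j * a j" "s * (\<delta> j * a j)"] by (auto simp: R_def)
  obtain d where d: "2 ^ d * (s * (\<delta> j * a j)) \<le> 16 * (s * a j)"
    "emeasure lborel (R s i \<inter> R s j) * ennreal ((2 ^ d * (s * (\<delta> j * a j)))\<^sup>2)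
      \<le> ennreal (4096 * (s * a j) * (s * (\<delta> j * a j)))
        * emeasure lborel (crect (c i) (u i) (v i) (6 * (s * a i)) (6 * (s * (\<delta> i * a i)))
            \<inter> cball x (2 ^ d * (s * (\<delta> j * a j))))"
    unfolding R_def
    by (rule crect_Int_measure_le[OF orthonormal[OF i] orthonormal[OF j], of "s * (\<delta> i * a i)"
          "s * (\<delta> j * a j)" "s * a j" "s * a i" z "c i" "c j" x])
      (use z xR pos s le in \<open>auto simp: R_def\<close>)
  define r where "r = radius s (j, d)"
  have r: "r = 2 ^ d * (s * (\<delta> j * a j))" "0 < r" using s pos by (auto simp: r_def radius_def)
  have dS: "d \<in> scales j" using d(1) s pos by (simp add: scales_def field_simps)
  define m where "m = emeasure lborel (R s i \<inter> R s j)"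
  define m' where "m' = emeasure lborel (R (6 * s) i \<inter> cball x r)"
  have d2: "m * ennreal (r\<^sup>2) \<le> ennreal (4096 * (s * a j) * (s * (\<delta> j * a j))) * m'"
    using d(2) by (simp add: m_def m'_def r(1) R_def mult.assoc)
  have "ennreal (weight s j) = ennreal (weight s j / r\<^sup>2) * ennreal (r\<^sup>2)"
    using r(2) weight_nonneg[OF j, of s] by (simp flip: ennreal_mult)
  then have "ennreal (weight s j) * m = ennreal (weight s j / r\<^sup>2) * (m * ennreal (r\<^sup>2))"
    by (simp only: mult_ac)
  also have "\<dots> \<le> ennreal (weight s j / r\<^sup>2) * (ennreal (4096 * (s * a j) * (s * (\<delta> j * a j))) * m')"
    by (rule mult_left_mono[OF d2]) simp
  also have "\<dots> = ennreal (weight s j / r\<^sup>2 * (4096 * (s * a j) * (s * (\<delta> j * a j)))) * m'"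
    using r weight_nonneg[OF j, of s] s pos by (intro ennreal_mult_assoc) auto
  also have "weight s j / r\<^sup>2 * (4096 * (s * a j) * (s * (\<delta> j * a j))) = 1024 * (1 / r\<^sup>2 * \<kappa> j)"
    using s pos r(2) by (simp add: weight_def power2_eq_square)
  also have "ennreal (1024 * (1 / r\<^sup>2 * \<kappa> j)) * m' = ennreal 1024 * (ennreal (1 / r\<^sup>2) * (ennreal (\<kappa> j) * m'))"
    using pos by (subst ennreal_mult_assoc, simp, simp, subst ennreal_mult_assoc) (simp_all add: mult.assoc)
  also have "\<dots> \<le> ennreal 1024 * (\<Sum>d\<in>scales j. ennreal (1 / (radius s (j, d))\<^sup>2) * (ennreal (\<kappa> j)
        * emeasure lborel (R (6 * s) i \<inter> cball x (radius s (j, d)))))"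
    unfolding m'_def r_def using dS card_scales(1)[OF j]
    by (intro mult_left_mono member_le_sum) auto
  finally show ?thesis by (simp add: m_def)
qed

definition majorant_part :: "(real^2 \<Rightarrow> ennreal) \<Rightarrow> real \<Rightarrow> 'i \<Rightarrow> real^2 \<Rightarrow> ennreal" where
  "majorant_part g s j y = (\<Sum>d\<in>scales j. ennreal (1 / (radius s (j, d))\<^sup>2)
     * (\<integral>\<^sup>+x. (share (j, d) x * g x) * indicator (cball y (radius s (j, d))) x \<partial>lborel))"

lemma majorant_eq_sum: "majorant g s y = (\<Sum>j\<in>I. majorant_part g s j y)"
  unfolding majorant_def majorant_part_def ball_superposition_def
  using finite_I card_scales by (subst sum.Sigma) (auto intro!: sum.cong)

lemma majorant_part_measurable:
  assumes [measurable]: "g \<in> borel_measurable lborel" and j: "j \<in> I"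
  shows "majorant_part g s j \<in> borel_measurable lborel"
proof -
  have [measurable]: "share (j, d) \<in> borel_measurable lborel" if "d \<in> scales j" for d
    using share_measurable[of "(j, d)"] that j by auto
  show ?thesis
    unfolding majorant_part_def
    by (intro borel_measurable_sum borel_measurable_times_ennreal measurable_ball_integral) measurable
qed

text \<open>
  Integrate \<open>R_Int_measure_le\<close> against \<open>g\<close> over \<open>E j\<close> and interchange the integrals: the areas
  \<open>|6R \<inter> B(x, r)|\<close> become integrals over \<open>6R\<close> of disc averages of \<open>g\<close>. The constant is \<open>1024 * 9\<close>, where \<open>9\<close> undoes the
  normalisation of \<open>share\<close>.
\<close>

lemma mass_R_Int_le:
  assumes [measurable]: "g \<in> borel_measurable lborel"
    and i: "i \<in> I" and j: "j \<in> I" and le: "a j \<le> a i" and s: "1 \<le> s"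
  shows "ennreal (weight s j) * mass g j * emeasure lborel (R s i \<inter> R s j)
    \<le> ennreal 9216 * (\<integral>\<^sup>+y. indicator (R (6 * s) i) y * majorant_part g s j y \<partial>lborel)"
proof -
  have [measurable]: "E j \<in> sets lborel" using E_sets[OF j] by simp
  let ?r = "\<lambda>d. radius s (j, d)"
  let ?Q = "R (6 * s) i"
  define \<phi> where "\<phi> d x = share (j, d) x * g x" for d x
  have \<phi>_meas [measurable]: "\<phi> d \<in> borel_measurable lborel" for d
    unfolding \<phi>_def share_def by simp
  have \<phi>: "indicator (E j) x * g x * ennreal (\<kappa> j) = ennreal 9 * \<phi> d x" for d x
  proof -
    have "ennreal (\<kappa> j) = ennreal (9 * (\<kappa> j / 9))" by simp
    also have "\<dots> = ennreal 9 * ennreal (\<kappa> j / 9)" using \<kappa>_pos[OF j] by (intro ennreal_mult) auto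
    finally show ?thesis by (simp add: \<phi>_def share_def mult_ac)
  qed
  have swap: "(\<integral>\<^sup>+x. \<phi> d x * emeasure lborel (?Q \<inter> cball x \<rho>) \<partial>lborel)
      = (\<integral>\<^sup>+y. indicator ?Q y * (\<integral>\<^sup>+x. \<phi> d x * indicator (cball y \<rho>) x \<partial>lborel) \<partial>lborel)" for d \<rho>
  proof -
    have "emeasure lborel (?Q \<inter> cball x \<rho>) = (\<integral>\<^sup>+y. indicator ?Q y * indicator (cball x \<rho>) y \<partial>lborel)" for x
      by (simp flip: indicator_inter_arith)
    then show ?thesis by (simp only:) (rule nn_integral_ball_swap[symmetric]; simp)
  qed
  have emeas [measurable]: "(\<lambda>x. emeasure lborel (?Q \<inter> cball x \<rho>)) \<in> borel_measurable lborel" for \<rho>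
  proof -
    have "(\<lambda>x. \<integral>\<^sup>+y. indicator ?Q y * indicator (cball x \<rho>) y \<partial>lborel) \<in> borel_measurable lborel"
      by (rule measurable_ball_integral) simp
    then show ?thesis by (simp flip: indicator_inter_arith)
  qed
  have "ennreal (weight s j) * mass g j * emeasure lborel (R s i \<inter> R s j)
      = (\<integral>\<^sup>+x. (indicator (E j) x * g x) * (ennreal (weight s j) * emeasure lborel (R s i \<inter> R s j)) \<partial>lborel)"
    unfolding mass_def by (subst nn_integral_multc) (measurable, simp add: mult_ac)
  also have "\<dots> \<le> (\<integral>\<^sup>+x. (indicator (E j) x * g x) * (ennreal 1024 * (\<Sum>d\<in>scales j.
      ennreal (1 / (?r d)\<^sup>2) * (ennreal (\<kappa> j) * emeasure lborel (?Q \<inter> cball x (?r d))))) \<partial>lborel)"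
  proof (rule nn_integral_mono)
    fix x
    show "(indicator (E j) x * g x) * (ennreal (weight s j) * emeasure lborel (R s i \<inter> R s j))
      \<le> (indicator (E j) x * g x) * (ennreal 1024 * (\<Sum>d\<in>scales j.
        ennreal (1 / (?r d)\<^sup>2) * (ennreal (\<kappa> j) * emeasure lborel (?Q \<inter> cball x (?r d)))))"
    proof (cases "x \<in> E j")
      case True
      then show ?thesis by (intro mult_left_mono R_Int_measure_le i j le s) auto
    qed simp
  qed
  also have "\<dots> = (\<integral>\<^sup>+x. (\<Sum>d\<in>scales j. ennreal 9216 * (ennreal (1 / (?r d)\<^sup>2)
      * (\<phi> d x * emeasure lborel (?Q \<inter> cball x (?r d))))) \<partial>lborel)"
  proof (rule nn_integral_cong)
    fix x
    have "(indicator (E j) x * g x) * (ennreal 1024 * (\<Sum>d\<in>scales j.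
        ennreal (1 / (?r d)\<^sup>2) * (ennreal (\<kappa> j) * emeasure lborel (?Q \<inter> cball x (?r d)))))
      = (\<Sum>d\<in>scales j. ennreal 1024 * (ennreal (1 / (?r d)\<^sup>2)
          * ((indicator (E j) x * g x * ennreal (\<kappa> j)) * emeasure lborel (?Q \<inter> cball x (?r d)))))"
      by (simp add: sum_distrib_left mult_ac)
    also have "\<dots> = (\<Sum>d\<in>scales j. (ennreal 1024 * ennreal 9) * (ennreal (1 / (?r d)\<^sup>2)
          * (\<phi> d x * emeasure lborel (?Q \<inter> cball x (?r d)))))"
      by (intro sum.cong refl, subst \<phi>) (simp only: mult_ac)
    also have "ennreal 1024 * ennreal 9 = ennreal 9216"
      by (simp flip: ennreal_mult)
    finally show "(indicator (E j) x * g x) * (ennreal 1024 * (\<Sum>d\<in>scales j.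
        ennreal (1 / (?r d)\<^sup>2) * (ennreal (\<kappa> j) * emeasure lborel (?Q \<inter> cball x (?r d)))))
      = (\<Sum>d\<in>scales j. ennreal 9216 * (ennreal (1 / (?r d)\<^sup>2)
          * (\<phi> d x * emeasure lborel (?Q \<inter> cball x (?r d)))))" .
  qed
  also have "\<dots> = (\<Sum>d\<in>scales j. ennreal 9216 * (ennreal (1 / (?r d)\<^sup>2)
      * (\<integral>\<^sup>+x. \<phi> d x * emeasure lborel (?Q \<inter> cball x (?r d)) \<partial>lborel)))"
    by (subst nn_integral_sum, measurable, intro sum.cong refl, subst nn_integral_cmult, measurable,
        subst nn_integral_cmult, measurable)
  also have "\<dots> = (\<Sum>d\<in>scales j. ennreal 9216 * (\<integral>\<^sup>+y. ennreal (1 / (?r d)\<^sup>2) * (indicator ?Q y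
      * (\<integral>\<^sup>+x. \<phi> d x * indicator (cball y (?r d)) x \<partial>lborel)) \<partial>lborel))"
    unfolding swap
    by (intro sum.cong refl arg_cong2[of _ _ _ _ "(*)"] nn_integral_cmult[symmetric]) measurable
  also have "\<dots> = ennreal 9216 * (\<integral>\<^sup>+y. (\<Sum>d\<in>scales j. ennreal (1 / (?r d)\<^sup>2) * (indicator ?Q y
      * (\<integral>\<^sup>+x. \<phi> d x * indicator (cball y (?r d)) x \<partial>lborel))) \<partial>lborel)"
    by (subst nn_integral_sum) (measurable, simp add: sum_distrib_left)
  also have "\<dots> = ennreal 9216 * (\<integral>\<^sup>+y. indicator ?Q y * majorant_part g s j y \<partial>lborel)"
    unfolding majorant_part_def \<phi>_def[symmetric] by (simp add: sum_distrib_left mult_ac)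
  finally show ?thesis .
qed

text \<open>
  In the expanded square keep the pairs with \<open>a j \<le> a i\<close>. Summing \<open>mass_R_Int_le\<close> over \<open>j\<close>
  assembles the full majorant, and summing over \<open>i\<close> reassembles the adjoint for the dilated family.
  The constant is \<open>2 * 9216 * 36\<close>, where \<open>36\<close> compares the areas of a rectangle and its dilate.
\<close>

lemma adjoint_square_step:
  assumes g [measurable]: "g \<in> borel_measurable lborel" and s: "1 \<le> s"
  shows "(\<integral>\<^sup>+y. (adjoint g s y)\<^sup>2 \<partial>lborel)
    \<le> ennreal 663552 * (\<integral>\<^sup>+y. adjoint g (6 * s) y * majorant g s y \<partial>lborel)"
proof -
  let ?L = "\<lambda>i. {j\<in>I. a j \<le> a i}"
  define U where "U i y = ennreal (weight s i) * mass g i * indicator (R s i) y" for i y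
  have [measurable]: "U i \<in> borel_measurable lborel" for i unfolding U_def by measurable
  have [measurable]: "majorant g s \<in> borel_measurable lborel" by (rule majorant_measurable[OF g])
  have row: "(\<Sum>j\<in>?L i. \<integral>\<^sup>+y. U i y * U j y \<partial>lborel)
      \<le> ennreal (weight s i) * mass g i
        * (ennreal 9216 * (\<integral>\<^sup>+y. indicator (R (6 * s) i) y * majorant g s y \<partial>lborel))" if i: "i \<in> I" for i
  proof -
    have mp [measurable]: "majorant_part g s j \<in> borel_measurable lborel" if "j \<in> I" for j
      using that by (rule majorant_part_measurable[OF g])
    have "(\<integral>\<^sup>+y. U i y * U j y \<partial>lborel) = ennreal (weight s i) * mass g i
        * (ennreal (weight s j) * mass g j * emeasure lborel (R s i \<inter> R s j))" for j
    proof -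
      have "(\<integral>\<^sup>+y. U i y * U j y \<partial>lborel) = (\<integral>\<^sup>+y. (ennreal (weight s i) * mass g i
          * (ennreal (weight s j) * mass g j)) * indicator (R s i \<inter> R s j) y \<partial>lborel)"
        unfolding U_def indicator_inter_arith by (simp only: mult_ac)
      also have "\<dots> = ennreal (weight s i) * mass g i
          * (ennreal (weight s j) * mass g j) * emeasure lborel (R s i \<inter> R s j)"
        by (rule nn_integral_cmult_indicator) simp
      finally show ?thesis by (simp only: mult_ac)
    qed
    then have "(\<Sum>j\<in>?L i. \<integral>\<^sup>+y. U i y * U j y \<partial>lborel)
        = ennreal (weight s i) * mass g i * (\<Sum>j\<in>?L i. ennreal (weight s j) * mass g j
            * emeasure lborel (R s i \<inter> R s j))"
      by (simp add: sum_distrib_left)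
    also have "\<dots> \<le> ennreal (weight s i) * mass g i * (\<Sum>j\<in>?L i. ennreal 9216
        * (\<integral>\<^sup>+y. indicator (R (6 * s) i) y * majorant_part g s j y \<partial>lborel))"
      using i s by (intro mult_left_mono sum_mono mass_R_Int_le) auto
    also have "\<dots> \<le> ennreal (weight s i) * mass g i * (\<Sum>j\<in>I. ennreal 9216
        * (\<integral>\<^sup>+y. indicator (R (6 * s) i) y * majorant_part g s j y \<partial>lborel))"
      using finite_I by (intro mult_left_mono sum_mono2) auto
    also have "(\<Sum>j\<in>I. ennreal 9216 * (\<integral>\<^sup>+y. indicator (R (6 * s) i) y * majorant_part g s j y \<partial>lborel))
        = ennreal 9216 * (\<integral>\<^sup>+y. (\<Sum>j\<in>I. indicator (R (6 * s) i) y * majorant_part g s j y) \<partial>lborel)"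
      by (subst nn_integral_sum) (measurable, simp add: sum_distrib_left)
    finally show ?thesis by (simp add: majorant_eq_sum sum_distrib_left)
  qed
  have "(\<integral>\<^sup>+y. (adjoint g s y)\<^sup>2 \<partial>lborel) \<le> (\<integral>\<^sup>+y. 2 * (\<Sum>i\<in>I. \<Sum>j\<in>?L i. U i y * U j y) \<partial>lborel)"
    unfolding adjoint_def U_def[symmetric] by (intro nn_integral_mono sum_square_le_ordered_pairs finite_I)
  also have "\<dots> = 2 * (\<Sum>i\<in>I. \<Sum>j\<in>?L i. \<integral>\<^sup>+y. U i y * U j y \<partial>lborel)"
    by (simp add: nn_integral_cmult nn_integral_sum)
  also have "\<dots> \<le> 2 * (\<Sum>i\<in>I. ennreal (weight s i) * mass g i
        * (ennreal 9216 * (\<integral>\<^sup>+y. indicator (R (6 * s) i) y * majorant g s y \<partial>lborel)))"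
    by (intro mult_left_mono sum_mono row) auto
  also have "\<dots> = 2 * (\<Sum>i\<in>I. ennreal 331776 * (\<integral>\<^sup>+y. ennreal (weight (6 * s) i) * mass g i
        * indicator (R (6 * s) i) y * majorant g s y \<partial>lborel))"
  proof (rule arg_cong[of _ _ "(*) 2"], rule sum.cong[OF refl])
    fix i assume i: "i \<in> I"
    have "weight s i = 36 * weight (6 * s) i"
      using s \<delta>_range[OF i] a_pos[OF i] by (simp add: weight_def power2_eq_square field_simps)
    then have w: "ennreal (weight s i) = ennreal 36 * ennreal (weight (6 * s) i)"
      using weight_nonneg[OF i, of "6 * s"] by (simp add: ennreal_mult)
    have "(\<integral>\<^sup>+y. ennreal (weight (6 * s) i) * mass g i * indicator (R (6 * s) i) y * majorant g s y \<partial>lborel)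
        = ennreal (weight (6 * s) i) * mass g i * (\<integral>\<^sup>+y. indicator (R (6 * s) i) y * majorant g s y \<partial>lborel)"
      unfolding mult.assoc[of _ _ "majorant g s _"] by (intro nn_integral_cmult) measurable
    moreover have "ennreal 331776 = ennreal 36 * ennreal 9216" by (simp flip: ennreal_mult)
    ultimately show "ennreal (weight s i) * mass g i
        * (ennreal 9216 * (\<integral>\<^sup>+y. indicator (R (6 * s) i) y * majorant g s y \<partial>lborel))
      = ennreal 331776 * (\<integral>\<^sup>+y. ennreal (weight (6 * s) i) * mass g i
        * indicator (R (6 * s) i) y * majorant g s y \<partial>lborel)"
      unfolding w by (simp only: mult_ac)
  qed
  also have "\<dots> = (2 * ennreal 331776) * (\<integral>\<^sup>+y. (\<Sum>i\<in>I. ennreal (weight (6 * s) i) * mass g i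
        * indicator (R (6 * s) i) y * majorant g s y) \<partial>lborel)"
    by (subst nn_integral_sum) (measurable, simp add: sum_distrib_left mult.assoc)
  also have "2 * ennreal 331776 = ennreal 663552" by (simp flip: ennreal_mult ennreal_numeral)
  finally show ?thesis by (simp add: adjoint_def sum_distrib_right)
qed

lemma mass_finite:
  assumes [measurable]: "g \<in> borel_measurable lborel" and fin: "(\<integral>\<^sup>+x. (g x)\<^sup>2 \<partial>lborel) < \<infinity>"
    and i: "i \<in> I"
  shows "mass g i < \<infinity>"
proof -
  have [measurable]: "E i \<in> sets lborel" using E_sets[OF i] by simp
  have "(mass g i)\<^sup>2 \<le> (\<integral>\<^sup>+x. (indicator (E i) x)\<^sup>2 \<partial>lborel) * (\<integral>\<^sup>+x. (g x)\<^sup>2 \<partial>lborel)"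
    unfolding mass_def by (intro Cauchy_Schwarz_nn_integral) measurable
  also have "(\<integral>\<^sup>+x. (indicator (E i) x)\<^sup>2 \<partial>lborel) = (\<integral>\<^sup>+x. indicator (E i) x \<partial>lborel)"
    by (intro nn_integral_cong) (simp add: indicator_def)
  also have "\<dots> \<le> emeasure lborel (R 1 i)"
    using E_subset[OF i] E_sets[OF i] by (simp add: R_def emeasure_mono)
  also have "\<dots> = ennreal (4 * 1\<^sup>2 * (\<delta> i * (a i)\<^sup>2))" using i by (rule emeasure_R) simp
  also have "ennreal (4 * 1\<^sup>2 * (\<delta> i * (a i)\<^sup>2)) * (\<integral>\<^sup>+x. (g x)\<^sup>2 \<partial>lborel) < \<infinity>"
    using fin by (simp add: ennreal_mult_less_top)
  finally have "(mass g i)\<^sup>2 < \<infinity>" by (simp add: mult_right_mono)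
  then show ?thesis by (cases "mass g i") auto
qed

text \<open>
  \<open>adjoint_square_step\<close> along the dilations by \<open>6 ^ n\<close>, fed into \<open>bounded_square_iteration\<close>. For
  the finite family the norms are bounded in \<open>n\<close> because a larger rectangle has a smaller
  normalised indicator in \<open>L\<^sup>2\<close>.
\<close>

lemma adjoint_L2_bound:
  assumes g [measurable]: "g \<in> borel_measurable lborel" and fin: "(\<integral>\<^sup>+x. (g x)\<^sup>2 \<partial>lborel) < \<infinity>"
  shows "(\<integral>\<^sup>+y. (adjoint g 1 y)\<^sup>2 \<partial>lborel)
    \<le> ennreal ((663552 * (8 * pi))\<^sup>2) * (\<integral>\<^sup>+x. (g x)\<^sup>2 \<partial>lborel)"
proof -
  let ?P = "\<integral>\<^sup>+x. (g x)\<^sup>2 \<partial>lborel"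
  let ?Q = "\<lambda>n::nat. \<integral>\<^sup>+y. (adjoint g (6 ^ n) y)\<^sup>2 \<partial>lborel"
  have one: "1 \<le> (6 ^ n :: real)" for n :: nat by (rule one_le_power) simp
  have "?Q 0 \<le> ennreal ((663552 * (8 * pi))\<^sup>2) * ?P"
  proof (rule bounded_square_iteration)
    fix n :: nat
    have [measurable]: "majorant g (6 ^ n) \<in> borel_measurable lborel" by (rule majorant_measurable[OF g])
    have "(?Q n)\<^sup>2 \<le> (ennreal 663552 * (\<integral>\<^sup>+y. adjoint g (6 ^ Suc n) y * majorant g (6 ^ n) y \<partial>lborel))\<^sup>2"
      using adjoint_square_step[OF g one[of n]] by (intro power_mono) simp_all
    also have "\<dots> = ennreal (663552\<^sup>2) * (\<integral>\<^sup>+y. adjoint g (6 ^ Suc n) y * majorant g (6 ^ n) y \<partial>lborel)\<^sup>2"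
      by (subst power_mult_distrib) (simp add: ennreal_power del: ennreal_numeral)
    also have "\<dots> \<le> ennreal (663552\<^sup>2) * (?Q (Suc n) * (\<integral>\<^sup>+y. (majorant g (6 ^ n) y)\<^sup>2 \<partial>lborel))"
      by (intro mult_left_mono Cauchy_Schwarz_nn_integral) measurable
    also have "\<dots> \<le> ennreal (663552\<^sup>2) * (?Q (Suc n) * (ennreal ((8 * pi)\<^sup>2) * ?P))"
      by (intro mult_left_mono majorant_bound g) auto
    also have "\<dots> = (ennreal (663552\<^sup>2) * ennreal ((8 * pi)\<^sup>2)) * ?P * ?Q (Suc n)"
      by (simp only: mult_ac)
    also have "ennreal (663552\<^sup>2) * ennreal ((8 * pi)\<^sup>2) = ennreal ((663552 * (8 * pi))\<^sup>2)"
      unfolding power_mult_distrib[of 663552 "8 * pi"] by (intro ennreal_mult[symmetric]) auto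
    finally show "(?Q n)\<^sup>2 \<le> ennreal ((663552 * (8 * pi))\<^sup>2) * ?P * ?Q (Suc n)" .
  next
    fix n :: nat
    let ?s = "6 ^ n :: real"
    let ?B = "\<lambda>i. ennreal ((\<kappa> i)\<^sup>2 / (4 * (\<delta> i * (a i)\<^sup>2))) * (mass g i)\<^sup>2"
    have U: "(\<integral>\<^sup>+y. (ennreal (weight ?s i) * mass g i * indicator (R ?s i) y)\<^sup>2 \<partial>lborel) \<le> ?B i"
      if i: "i \<in> I" for i
    proof -
      have pos: "0 < \<kappa> i" "0 < \<delta> i" "0 < a i" using i \<kappa>_pos \<delta>_range a_pos by auto
      have "(\<integral>\<^sup>+y. (ennreal (weight ?s i) * mass g i * indicator (R ?s i) y)\<^sup>2 \<partial>lborel)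
          = (\<integral>\<^sup>+y. (ennreal (weight ?s i) * mass g i)\<^sup>2 * indicator (R ?s i) y \<partial>lborel)"
        by (intro nn_integral_cong) (simp add: indicator_def)
      also have "\<dots> = (ennreal (weight ?s i) * mass g i)\<^sup>2 * ennreal (4 * ?s\<^sup>2 * (\<delta> i * (a i)\<^sup>2))"
        using i by (subst nn_integral_cmult_indicator) (auto simp: emeasure_R)
      also have "\<dots> = ennreal ((weight ?s i)\<^sup>2 * (4 * ?s\<^sup>2 * (\<delta> i * (a i)\<^sup>2))) * (mass g i)\<^sup>2"
        using weight_nonneg[OF i, of ?s] pos
        by (subst ennreal_mult) (auto simp: power_mult_distrib ennreal_power mult_ac)
      also have "\<dots> \<le> ?B i"
      proof (intro mult_right_mono ennreal_leI)
        have "(weight ?s i)\<^sup>2 * (4 * ?s\<^sup>2 * (\<delta> i * (a i)\<^sup>2)) = (\<kappa> i)\<^sup>2 / (4 * (\<delta> i * (a i)\<^sup>2)) / ?s\<^sup>2"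
          using pos by (simp add: weight_def power2_eq_square field_simps)
        also have "\<dots> \<le> (\<kappa> i)\<^sup>2 / (4 * (\<delta> i * (a i)\<^sup>2)) / 1"
          using one[of n] pos by (intro divide_left_mono one_le_power) auto
        finally show "(weight ?s i)\<^sup>2 * (4 * ?s\<^sup>2 * (\<delta> i * (a i)\<^sup>2)) \<le> (\<kappa> i)\<^sup>2 / (4 * (\<delta> i * (a i)\<^sup>2))"
          by simp
      qed simp
      finally show ?thesis .
    qed
    have "?Q n \<le> (\<integral>\<^sup>+y. 2 * of_nat (card I)
        * (\<Sum>i\<in>I. (ennreal (weight ?s i) * mass g i * indicator (R ?s i) y)\<^sup>2) \<partial>lborel)"
      unfolding adjoint_def by (intro nn_integral_mono sum_square_le_card)
    also have "\<dots> = 2 * of_nat (card I)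
        * (\<Sum>i\<in>I. \<integral>\<^sup>+y. (ennreal (weight ?s i) * mass g i * indicator (R ?s i) y)\<^sup>2 \<partial>lborel)"
      by (subst nn_integral_cmult) (measurable, subst nn_integral_sum, measurable)
    also have "\<dots> \<le> 2 * of_nat (card I) * (\<Sum>i\<in>I. ?B i)"
      by (intro mult_left_mono sum_mono U) auto
    finally show "?Q n \<le> 2 * of_nat (card I) * (\<Sum>i\<in>I. ?B i)" .
  next
    have "(\<Sum>i\<in>I. ennreal ((\<kappa> i)\<^sup>2 / (4 * (\<delta> i * (a i)\<^sup>2))) * (mass g i)\<^sup>2) < \<infinity>"
      using mass_finite[OF g fin] finite_I
      by (simp add: ennreal_mult_less_top power_less_top_ennreal)
    then show "2 * of_nat (card I) * (\<Sum>i\<in>I. ennreal ((\<kappa> i)\<^sup>2 / (4 * (\<delta> i * (a i)\<^sup>2))) * (mass g i)\<^sup>2) < \<infinity>"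
      by (simp add: ennreal_mult_less_top of_nat_less_top)
  qed
  then show ?thesis by simp
qed

definition weighted_mean :: "(real^2 \<Rightarrow> ennreal) \<Rightarrow> 'i \<Rightarrow> ennreal" where
  "weighted_mean F i = ennreal (weight 1 i) * (\<integral>\<^sup>+y. F y * indicator (R 1 i) y \<partial>lborel)"

text \<open>
  Duality: with \<open>g\<close> the linearised maximal function itself, the integral of \<open>g\<^sup>2\<close> is that of
  \<open>F * adjoint g 1\<close>, so the bound for the adjoint gives a quadratic inequality for the integral of
  \<open>g\<^sup>2\<close>. That integral is finite for a finite family, hence one factor may be cancelled.
\<close>

lemma linearised_L2_bound:
  assumes F [measurable]: "F \<in> borel_measurable lborel" and fin: "(\<integral>\<^sup>+x. (F x)\<^sup>2 \<partial>lborel) < \<infinity>"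
  shows "(\<integral>\<^sup>+x. (\<Sum>i\<in>I. weighted_mean F i * indicator (E i) x)\<^sup>2 \<partial>lborel)
    \<le> ennreal ((663552 * (8 * pi))\<^sup>2) * (\<integral>\<^sup>+x. (F x)\<^sup>2 \<partial>lborel)"
proof -
  define g where "g x = (\<Sum>i\<in>I. weighted_mean F i * indicator (E i) x)" for x
  let ?P = "\<integral>\<^sup>+x. (F x)\<^sup>2 \<partial>lborel" and ?G = "\<integral>\<^sup>+x. (g x)\<^sup>2 \<partial>lborel"
  have E_meas [measurable]: "E i \<in> sets lborel" if "i \<in> I" for i using E_sets[OF that] by simp
  have g [measurable]: "g \<in> borel_measurable lborel" unfolding g_def by measurable
  have mean_finite: "weighted_mean F i < \<infinity>" if i: "i \<in> I" for i
  proof -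
    have "(\<integral>\<^sup>+y. F y * indicator (R 1 i) y \<partial>lborel)\<^sup>2
        \<le> ?P * (\<integral>\<^sup>+y. (indicator (R 1 i) y)\<^sup>2 \<partial>lborel)"
      by (intro Cauchy_Schwarz_nn_integral) measurable
    also have "(\<integral>\<^sup>+y. (indicator (R 1 i) y :: ennreal)\<^sup>2 \<partial>lborel) = (\<integral>\<^sup>+y. indicator (R 1 i) y \<partial>lborel)"
      by (intro nn_integral_cong) (simp add: indicator_def)
    also have "\<dots> = ennreal (4 * 1\<^sup>2 * (\<delta> i * (a i)\<^sup>2))" using emeasure_R[OF i, of 1] by simp
    also have "?P * ennreal (4 * 1\<^sup>2 * (\<delta> i * (a i)\<^sup>2)) < \<infinity>"
      using fin by (simp add: ennreal_mult_less_top)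
    finally have "(\<integral>\<^sup>+y. F y * indicator (R 1 i) y \<partial>lborel)\<^sup>2 < \<infinity>" .
    then have "(\<integral>\<^sup>+y. F y * indicator (R 1 i) y \<partial>lborel) < \<infinity>"
      by (cases "\<integral>\<^sup>+y. F y * indicator (R 1 i) y \<partial>lborel") auto
    then show ?thesis by (simp add: weighted_mean_def ennreal_mult_less_top)
  qed
  have "?G \<le> (\<integral>\<^sup>+x. 2 * of_nat (card I) * (\<Sum>i\<in>I. (weighted_mean F i * indicator (E i) x)\<^sup>2) \<partial>lborel)"
    unfolding g_def by (intro nn_integral_mono sum_square_le_card)
  also have "\<dots> = 2 * of_nat (card I) * (\<Sum>i\<in>I. \<integral>\<^sup>+x. (weighted_mean F i * indicator (E i) x)\<^sup>2 \<partial>lborel)"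
    by (subst nn_integral_cmult) (measurable, subst nn_integral_sum, measurable)
  also have "\<dots> < \<infinity>"
  proof -
    have "(\<integral>\<^sup>+x. (weighted_mean F i * indicator (E i) x)\<^sup>2 \<partial>lborel) < \<infinity>" if i: "i \<in> I" for i
    proof -
      have "(\<integral>\<^sup>+x. (weighted_mean F i * indicator (E i) x)\<^sup>2 \<partial>lborel)
          \<le> (\<integral>\<^sup>+x. (weighted_mean F i)\<^sup>2 * indicator (R 1 i) x \<partial>lborel)"
        using E_subset[OF i] by (intro nn_integral_mono) (auto simp: indicator_def R_def)
      also have "\<dots> = (weighted_mean F i)\<^sup>2 * ennreal (4 * 1\<^sup>2 * (\<delta> i * (a i)\<^sup>2))"
        using emeasure_R[OF i, of 1] by (simp add: nn_integral_cmult_indicator)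
      also have "\<dots> < \<infinity>"
        using mean_finite[OF i] by (simp add: ennreal_mult_less_top power_less_top_ennreal)
      finally show ?thesis .
    qed
    then show ?thesis using finite_I by (simp add: ennreal_mult_less_top of_nat_less_top)
  qed
  finally have G: "?G < \<infinity>" .
  have "?G = (\<integral>\<^sup>+x. (\<Sum>i\<in>I. weighted_mean F i * (indicator (E i) x * g x)) \<partial>lborel)"
  proof (intro nn_integral_cong)
    fix x
    have "(g x)\<^sup>2 = (\<Sum>i\<in>I. weighted_mean F i * indicator (E i) x) * g x"
      by (simp only: power2_eq_square g_def)
    then show "(g x)\<^sup>2 = (\<Sum>i\<in>I. weighted_mean F i * (indicator (E i) x * g x))"
      by (simp only: sum_distrib_right mult.assoc)
  qed
  also have "\<dots> = (\<Sum>i\<in>I. weighted_mean F i * mass g i)"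
    unfolding mass_def by (subst nn_integral_sum) (auto intro!: sum.cong nn_integral_cmult)
  also have "\<dots> = (\<Sum>i\<in>I. \<integral>\<^sup>+y. ennreal (weight 1 i) * mass g i * (F y * indicator (R 1 i) y) \<partial>lborel)"
    unfolding weighted_mean_def by (intro sum.cong refl, subst nn_integral_cmult, measurable, simp only: mult_ac)
  also have "\<dots> = (\<integral>\<^sup>+y. F y * adjoint g 1 y \<partial>lborel)"
    by (subst nn_integral_sum[symmetric]) (measurable, simp add: adjoint_def sum_distrib_left mult_ac)
  finally have "?G\<^sup>2 = (\<integral>\<^sup>+y. F y * adjoint g 1 y \<partial>lborel)\<^sup>2" by simp
  also have "\<dots> \<le> ?P * (\<integral>\<^sup>+y. (adjoint g 1 y)\<^sup>2 \<partial>lborel)"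
    by (intro Cauchy_Schwarz_nn_integral) measurable
  also have "\<dots> \<le> ?P * (ennreal ((663552 * (8 * pi))\<^sup>2) * ?G)"
    by (intro mult_left_mono adjoint_L2_bound g G) simp
  finally have "?G * ?G \<le> ?G * (ennreal ((663552 * (8 * pi))\<^sup>2) * ?P)"
    by (simp only: power2_eq_square mult_ac)
  then have "?G = 0 \<or> ?G \<le> ennreal ((663552 * (8 * pi))\<^sup>2) * ?P"
    using G by (metis ennreal_mult_le_mult_iff infinity_ennreal_def less_irrefl)
  then show ?thesis unfolding g_def[symmetric] by (metis zero_le)
qed

end

section \<open>From finite families to all rectangles\<close>

text \<open>
  Centre, directions of the long and the short side, half of the long side, and eccentricity.
\<close>

type_synonym rectangle_params = "(real^2) \<times> (real^2) \<times> (real^2) \<times> real \<times> real"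

definition admissible :: "rectangle_params set" where
  "admissible = {(c, u, v, a, \<delta>). orthonormal u v \<and> 0 < a \<and> 0 < \<delta> \<and> \<delta> < 1/2}"

definition rect :: "rectangle_params \<Rightarrow> (real^2) set" where
  "rect = (\<lambda>(c, u, v, a, \<delta>). crect c u v a (\<delta> * a))"

definition weighted_average :: "(real^2 \<Rightarrow> ennreal) \<Rightarrow> rectangle_params \<Rightarrow> ennreal" where
  "weighted_average F = (\<lambda>(c, u, v, a, \<delta>). ennreal (1 / \<bar>ln \<delta>\<bar> / (4 * (\<delta> * a\<^sup>2)))
     * (\<integral>\<^sup>+y. F y * indicator (crect c u v a (\<delta> * a)) y \<partial>lborel))"

lemma rect_sets [measurable, simp]: "rect t \<in> sets borel"
  by (cases t) (simp add: rect_def)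

text \<open>
  Let each point of the union be served by the rectangle through it with the largest weighted
  average. The linearised operator is then the maximal function itself.
\<close>

lemma finite_maximal_L2_bound:
  fixes t :: "nat \<Rightarrow> rectangle_params"
  assumes F [measurable]: "F \<in> borel_measurable lborel" and fin: "(\<integral>\<^sup>+x. (F x)\<^sup>2 \<partial>lborel) < \<infinity>"
    and t: "\<And>i. t i \<in> admissible"
  shows "(\<integral>\<^sup>+x. (SUP i\<in>{..<n}. weighted_average F (t i) * indicator (rect (t i)) x)\<^sup>2 \<partial>lborel)
    \<le> ennreal ((663552 * (8 * pi))\<^sup>2) * (\<integral>\<^sup>+x. (F x)\<^sup>2 \<partial>lborel)"
proof -
  define W where "W i = weighted_average F (t i)" for i
  \<comment> \<open>Ties are broken by the index, so that exactly one rectangle serves each point of the union.\<close>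
  define beats where "beats i j \<longleftrightarrow> W j < W i \<or> W j = W i \<and> i \<le> j" for i j
  define E where "E i = rect (t i) - (\<Union>j\<in>{j. j < n \<and> \<not> beats i j}. rect (t j))" for i
  define c where "c i = fst (t i)" for i
  define u where "u i = fst (snd (t i))" for i
  define v where "v i = fst (snd (snd (t i)))" for i
  define a where "a i = fst (snd (snd (snd (t i))))" for i
  define \<delta> where "\<delta> i = snd (snd (snd (snd (t i))))" for i
  have ti: "t i = (c i, u i, v i, a i, \<delta> i)" for i
    by (simp add: c_def u_def v_def a_def \<delta>_def)
  interpret rectangle_selection "{..<n}" c u v a \<delta> E
  proof
    fix i j x assume ij: "i \<in> {..<n}" "j \<in> {..<n}" "x \<in> E i" "x \<in> E j"
    then have "beats i j" "beats j i" by (auto simp: E_def)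
    then show "i = j" unfolding beats_def by (metis less_asym' less_irrefl order_antisym)
  next
    fix i show "E i \<in> sets borel" unfolding E_def by (intro sets.Diff sets.finite_UN) auto
  next
    fix i show "E i \<subseteq> crect (c i) (u i) (v i) (a i) (\<delta> i * a i)"
      by (auto simp: E_def rect_def ti)
  qed (use t ti in \<open>auto simp: admissible_def\<close>)
  have weighted_mean: "weighted_mean F i = W i" for i
    by (simp add: weighted_mean_def W_def weighted_average_def ti weight_def \<kappa>_def R_def)
  have "(SUP i\<in>{..<n}. W i * indicator (rect (t i)) x) \<le> (\<Sum>i\<in>{..<n}. W i * indicator (E i) x)" for x
  proof (rule SUP_least)
    fix i assume i: "i \<in> {..<n}"
    show "W i * indicator (rect (t i)) x \<le> (\<Sum>i\<in>{..<n}. W i * indicator (E i) x)"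
    proof (cases "x \<in> rect (t i)")
      case True
      define J where "J = {j. j < n \<and> x \<in> rect (t j)}"
      have J: "finite J" "i \<in> J" using i True by (auto simp: J_def)
      define best where "best = Max (W ` J)"
      define k where "k = (LEAST j. j \<in> J \<and> W j = best)"
      have "best \<in> W ` J" unfolding best_def using J by (intro Max_in) auto
      then obtain l where l: "l \<in> J" "W l = best" by auto
      have k: "k \<in> J" "W k = best"
        unfolding k_def using LeastI[of "\<lambda>j. j \<in> J \<and> W j = best" l] l by auto
      have "beats k j" if j: "j \<in> J" for j
      proof -
        have "W j \<le> W k" using J j k by (simp add: best_def)
        moreover have "k \<le> j" if "W j = W k"
          using Least_le[of "\<lambda>j. j \<in> J \<and> W j = best" j] j k that by (simp add: k_def)
        ultimately show ?thesis by (auto simp: beats_def)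
      qed
      then have kE: "x \<in> E k" using k by (auto simp: E_def J_def)
      have "W i * indicator (rect (t i)) x \<le> W k * indicator (E k) x"
        using J k kE by (simp add: best_def indicator_def)
      also have "\<dots> \<le> (\<Sum>i\<in>{..<n}. W i * indicator (E i) x)"
        using k by (intro member_le_sum) (auto simp: J_def)
      finally show ?thesis .
    qed simp
  qed
  then have "(\<integral>\<^sup>+x. (SUP i\<in>{..<n}. W i * indicator (rect (t i)) x)\<^sup>2 \<partial>lborel)
      \<le> (\<integral>\<^sup>+x. (\<Sum>i\<in>{..<n}. weighted_mean F i * indicator (E i) x)\<^sup>2 \<partial>lborel)"
    unfolding weighted_mean by (intro nn_integral_mono power_mono) auto
  also have "\<dots> \<le> ennreal ((663552 * (8 * pi))\<^sup>2) * (\<integral>\<^sup>+x. (F x)\<^sup>2 \<partial>lborel)"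
    by (rule linearised_L2_bound[OF F fin])
  finally show ?thesis by (simp add: W_def)
qed

lemma countable_maximal_L2_bound:
  fixes t :: "nat \<Rightarrow> rectangle_params"
  assumes F [measurable]: "F \<in> borel_measurable lborel" and fin: "(\<integral>\<^sup>+x. (F x)\<^sup>2 \<partial>lborel) < \<infinity>"
    and t: "\<And>i. t i \<in> admissible"
  shows "(\<integral>\<^sup>+x. (SUP i. weighted_average F (t i) * indicator (rect (t i)) x)\<^sup>2 \<partial>lborel)
    \<le> ennreal ((663552 * (8 * pi))\<^sup>2) * (\<integral>\<^sup>+x. (F x)\<^sup>2 \<partial>lborel)"
proof -
  define W where "W i x = weighted_average F (t i) * indicator (rect (t i)) x" for i x
  define M where "M n x = (SUP i\<in>{..<n}. W i x)" for n x
  have [measurable]: "W i \<in> borel_measurable lborel" for i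
    unfolding W_def by (intro borel_measurable_times_ennreal borel_measurable_indicator) auto
  have [measurable]: "M n \<in> borel_measurable lborel" for n unfolding M_def by measurable
  have mono: "M m x \<le> M n x" if "m \<le> n" for m n x
    unfolding M_def using that by (intro SUP_subset_mono) auto
  have "(SUP i. W i x)\<^sup>2 \<le> (SUP n. (M n x)\<^sup>2)" for x
  proof -
    have le: "W i x \<le> M n x" if "i < n" for i n
      unfolding M_def using that by (intro SUP_upper) simp
    have "W i x * W j x \<le> (SUP n. (M n x)\<^sup>2)" for i j
    proof (rule SUP_upper2)
      let ?n = "Suc (max i j)"
      show "W i x * W j x \<le> (M ?n x)\<^sup>2"
        unfolding power2_eq_square by (intro mult_mono le) auto
    qed simp
    then show ?thesis
      by (simp add: power2_eq_square SUP_mult_left_ennreal SUP_mult_right_ennreal SUP_least)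
  qed
  then have "(\<integral>\<^sup>+x. (SUP i. W i x)\<^sup>2 \<partial>lborel) \<le> (\<integral>\<^sup>+x. (SUP n. (M n x)\<^sup>2) \<partial>lborel)"
    by (intro nn_integral_mono)
  also have "\<dots> = (SUP n. \<integral>\<^sup>+x. (M n x)\<^sup>2 \<partial>lborel)"
    using mono by (intro nn_integral_monotone_convergence_SUP)
      (auto simp: incseq_def le_fun_def intro!: power_mono)
  also have "\<dots> \<le> ennreal ((663552 * (8 * pi))\<^sup>2) * (\<integral>\<^sup>+x. (F x)\<^sup>2 \<partial>lborel)"
    unfolding M_def W_def by (intro SUP_least finite_maximal_L2_bound F fin t)
  finally show ?thesis by (simp add: W_def)
qed

text \<open>
  Dilating a rectangle by \<open>s > 1\<close> about its centre keeps the eccentricity, brings all its points into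
  the interior, and lowers the average by a factor of at most \<open>s\<^sup>2\<close>.
\<close>

lemma weighted_average_dilate:
  assumes t: "t \<in> admissible" and x: "x \<in> rect t" and q: "q < weighted_average F t"
  obtains t' where "t' \<in> admissible" "x \<in> interior (rect t')" "q < weighted_average F t'"
proof -
  obtain c u v a \<delta> where td: "t = (c, u, v, a, \<delta>)" by (cases t)
  have pos: "orthonormal u v" "0 < a" "0 < \<delta>" "\<delta> < 1/2" using t by (auto simp: td admissible_def)
  define dil where "dil s = (c, u, v, s * a, \<delta>)" for s :: real
  have dil_admissible: "dil s \<in> admissible" if "1 < s" for s
    using pos that by (simp add: dil_def admissible_def)
  have dil_interior: "x \<in> interior (rect (dil s))" if s: "1 < s" for s
  proof (rule interiorI)
    let ?O = "{y. \<bar>(y - c) \<bullet> u\<bar> < s * a \<and> \<bar>(y - c) \<bullet> v\<bar> < \<delta> * (s * a)}"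
    show "open ?O" by (intro open_Collect_conj open_Collect_less continuous_intros)
    show "?O \<subseteq> rect (dil s)" by (auto simp: rect_def dil_def crect_def)
    have "a < s * a" "\<delta> * a < \<delta> * (s * a)" using pos s by auto
    then show "x \<in> ?O" using x by (auto simp: td rect_def crect_def)
  qed
  have dil_average: "ennreal (1 / s\<^sup>2) * weighted_average F t \<le> weighted_average F (dil s)" if s: "1 < s" for s
  proof -
    let ?k = "1 / \<bar>ln \<delta>\<bar> / (4 * (\<delta> * a\<^sup>2))"
    have "ennreal (1 / s\<^sup>2) * weighted_average F t
        = ennreal (1 / s\<^sup>2 * ?k) * (\<integral>\<^sup>+y. F y * indicator (crect c u v a (\<delta> * a)) y \<partial>lborel)"
      unfolding weighted_average_def td prod.case using pos
      by (intro ennreal_mult_assoc divide_nonneg_nonneg mult_nonneg_nonneg) auto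
    also have "1 / s\<^sup>2 * ?k = 1 / \<bar>ln \<delta>\<bar> / (4 * (\<delta> * (s * a)\<^sup>2))"
      by (simp add: power2_eq_square)
    also have "ennreal (1 / \<bar>ln \<delta>\<bar> / (4 * (\<delta> * (s * a)\<^sup>2)))
          * (\<integral>\<^sup>+y. F y * indicator (crect c u v a (\<delta> * a)) y \<partial>lborel)
        \<le> ennreal (1 / \<bar>ln \<delta>\<bar> / (4 * (\<delta> * (s * a)\<^sup>2)))
          * (\<integral>\<^sup>+y. F y * indicator (crect c u v (s * a) (\<delta> * (s * a))) y \<partial>lborel)"
    proof (intro mult_left_mono nn_integral_mono indicator_leI)
      fix y assume y: "y \<in> crect c u v a (\<delta> * a)"
      have "a \<le> s * a" "\<delta> * a \<le> \<delta> * (s * a)" using pos s by auto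
      with y show "y \<in> crect c u v (s * a) (\<delta> * (s * a))"
        using crect_mono by blast
    qed auto
    finally show ?thesis by (simp add: weighted_average_def dil_def)
  qed
  have "\<exists>s>1. q < ennreal (1 / s\<^sup>2) * weighted_average F t"
  proof (cases "weighted_average F t")
    case (real w)
    obtain p where p: "q = ennreal p" "0 \<le> p" using q real by (cases q) auto
    have pw: "p < w" using q real p by (simp add: ennreal_less_iff)
    \<comment> \<open>Chosen so that \<open>w / s\<^sup>2\<close> is the midpoint of \<open>p\<close> and \<open>w\<close>.\<close>
    define s where "s = sqrt (2 * w / (w + p))"
    have "1 < s" using pw p by (simp add: s_def)
    moreover have "s\<^sup>2 = 2 * w / (w + p)" using pw p by (simp add: s_def)
    then have "1 / s\<^sup>2 * w = (w + p) / 2" using pw p by simp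
    then have "ennreal (1 / s\<^sup>2) * weighted_average F t = ennreal ((w + p) / 2)"
      using pw p by (simp add: real flip: ennreal_mult)
    then have "q < ennreal (1 / s\<^sup>2) * weighted_average F t"
      using pw p by (simp add: ennreal_less_iff)
    ultimately show ?thesis by blast
  next
    case top
    then show ?thesis using q by (intro exI[of _ 2]) (simp add: ennreal_mult_top)
  qed
  then obtain s where s: "1 < s" "q < ennreal (1 / s\<^sup>2) * weighted_average F t" by blast
  then show thesis using that[of "dil s"] dil_admissible dil_interior dil_average by fastforce
qed

text \<open>
  For each rational \<open>q\<close>, the interiors of the rectangles with weighted average above \<open>q\<close> cover the set
  where the supremum exceeds \<open>q\<close>, by \<open>weighted_average_dilate\<close>. Countably many of them suffice, and
  the union of these subfamilies over all \<open>q\<close> realises the supremum at every point.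
\<close>

lemma countable_maximal_family:
  obtains t :: "nat \<Rightarrow> rectangle_params" where "\<And>i. t i \<in> admissible"
    "\<And>x. (SUP t\<in>{t \<in> admissible. x \<in> rect t}. weighted_average F t)
      = (SUP i. weighted_average F (t i) * indicator (rect (t i)) x)"
proof -
  let ?W = "weighted_average F"
  define S where "S q = {t \<in> admissible. ennreal (real_of_rat q) < ?W t}" for q
  have "\<exists>C\<subseteq>S q. countable C \<and> (\<Union>t\<in>C. interior (rect t)) = (\<Union>t\<in>S q. interior (rect t))" for q
  proof -
    obtain D where D: "D \<subseteq> (\<lambda>t. interior (rect t)) ` S q" "countable D"
      "\<Union>D = \<Union>((\<lambda>t. interior (rect t)) ` S q)"
      by (rule Lindelof[of "(\<lambda>t. interior (rect t)) ` S q"]) auto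
    then obtain C where "C \<subseteq> S q" "countable C" "D = (\<lambda>t. interior (rect t)) ` C"
      by (meson countable_subset_image)
    with D(3) show ?thesis by blast
  qed
  then obtain C where C: "\<And>q. C q \<subseteq> S q" "\<And>q. countable (C q)"
    "\<And>q. (\<Union>t\<in>C q. interior (rect t)) = (\<Union>t\<in>S q. interior (rect t))"
    by metis
  \<comment> \<open>An arbitrary rectangle, so that the family is nonempty even when all averages vanish.\<close>
  define t0 :: rectangle_params where "t0 = (0, axis 1 1, axis 2 1, 1, 1/4)"
  have t0: "t0 \<in> admissible"
    by (simp add: t0_def admissible_def orthonormal_def inner_axis_axis)
  define \<C> where "\<C> = insert t0 (\<Union>q. C q)"
  have \<C>: "countable \<C>" "\<C> \<noteq> {}" "\<C> \<subseteq> admissible"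
    using C(1,2) t0 by (auto simp: \<C>_def S_def)
  define t where "t = from_nat_into \<C>"
  have range: "range t = \<C>" unfolding t_def using \<C> by (intro range_from_nat_into)
  show thesis
  proof (rule that)
    show tt: "t i \<in> admissible" for i using range \<C>(3) by blast
    fix x
    show "(SUP t\<in>{t \<in> admissible. x \<in> rect t}. ?W t) = (SUP i. ?W (t i) * indicator (rect (t i)) x)"
    proof (rule antisym)
      show "(SUP t\<in>{t \<in> admissible. x \<in> rect t}. ?W t) \<le> (SUP i. ?W (t i) * indicator (rect (t i)) x)"
      proof (rule ccontr)
        assume "\<not> ?thesis"
        then have "(SUP i. ?W (t i) * indicator (rect (t i)) x) < (SUP t\<in>{t \<in> admissible. x \<in> rect t}. ?W t)"
          by simp
        then obtain q where q: "(SUP i. ?W (t i) * indicator (rect (t i)) x) < ennreal (real_of_rat q)"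
          "ennreal (real_of_rat q) < (SUP t\<in>{t \<in> admissible. x \<in> rect t}. ?W t)"
          using ennreal_rat_dense by blast
        from q(2) obtain r where r: "r \<in> admissible" "x \<in> rect r" "ennreal (real_of_rat q) < ?W r"
          by (auto simp: less_SUP_iff)
        obtain r' where "r' \<in> admissible" "x \<in> interior (rect r')" "ennreal (real_of_rat q) < ?W r'"
          using weighted_average_dilate[OF r] by metis
        then have "x \<in> (\<Union>t\<in>S q. interior (rect t))" unfolding S_def by blast
        then obtain p where p: "p \<in> C q" "x \<in> interior (rect p)" unfolding C(3)[symmetric] by auto
        then have "p \<in> range t" by (auto simp: range \<C>_def)
        then obtain i where i: "p = t i" by auto
        have "ennreal (real_of_rat q) < ?W p" using p C(1) by (auto simp: S_def)
        also have "?W p = ?W (t i) * indicator (rect (t i)) x"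
          using p interior_subset i by (auto simp: indicator_def)
        also have "\<dots> \<le> (SUP i. ?W (t i) * indicator (rect (t i)) x)" by (rule SUP_upper) simp
        finally show False using q(1) by simp
      qed
      show "(SUP i. ?W (t i) * indicator (rect (t i)) x) \<le> (SUP t\<in>{t \<in> admissible. x \<in> rect t}. ?W t)"
      proof (rule SUP_least)
        fix i
        show "?W (t i) * indicator (rect (t i)) x \<le> (SUP t\<in>{t \<in> admissible. x \<in> rect t}. ?W t)"
          by (cases "x \<in> rect (t i)") (auto intro!: SUP_upper tt)
      qed
    qed
  qed
qed

lemma rectangle_eq_crect:
  assumes "orthonormal u v"
  shows "rectangle p u v h w = crect (p + (h / 2) *\<^sub>R u + (w / 2) *\<^sub>R v) u v (h / 2) (w / 2)"
proof -
  have uv: "u \<bullet> u = 1" "v \<bullet> v = 1" "u \<bullet> v = 0" "v \<bullet> u = 0"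
    using assms by (auto simp: orthonormal_def norm_eq_1 inner_commute)
  have mem: "y \<in> crect (p + (h / 2) *\<^sub>R u + (w / 2) *\<^sub>R v) u v (h / 2) (w / 2)
      \<longleftrightarrow> 0 \<le> (y - p) \<bullet> u \<and> (y - p) \<bullet> u \<le> h \<and> 0 \<le> (y - p) \<bullet> v \<and> (y - p) \<bullet> v \<le> w" for y
  proof -
    let ?c = "p + (h / 2) *\<^sub>R u + (w / 2) *\<^sub>R v"
    have "(y - ?c) \<bullet> u = (y - p) \<bullet> u - h / 2" "(y - ?c) \<bullet> v = (y - p) \<bullet> v - w / 2"
      by (simp_all add: inner_diff_left inner_add_left uv)
    moreover have "\<bar>z - k / 2\<bar> \<le> k / 2 \<longleftrightarrow> 0 \<le> z \<and> z \<le> k" for z k :: real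
      by linarith
    ultimately show ?thesis by (simp only: crect_def mem_Collect_eq conj_assoc)
  qed
  show ?thesis
  proof (intro equalityI subsetI)
    fix y assume "y \<in> rectangle p u v h w"
    then obtain s t where "y = p + s *\<^sub>R u + t *\<^sub>R v" "0 \<le> s" "s \<le> h" "0 \<le> t" "t \<le> w"
      by (auto simp: rectangle_def)
    then show "y \<in> crect (p + (h / 2) *\<^sub>R u + (w / 2) *\<^sub>R v) u v (h / 2) (w / 2)"
      unfolding mem by (simp add: inner_add_left uv)
  next
    fix y assume "y \<in> crect (p + (h / 2) *\<^sub>R u + (w / 2) *\<^sub>R v) u v (h / 2) (w / 2)"
    moreover have "p + (y - p) = p + (((y - p) \<bullet> u) *\<^sub>R u + ((y - p) \<bullet> v) *\<^sub>R v)"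
      by (rule arg_cong[OF orthonormal_expand[OF assms]])
    then have "y = p + ((y - p) \<bullet> u) *\<^sub>R u + ((y - p) \<bullet> v) *\<^sub>R v"
      by (simp only: add.assoc[symmetric] add_diff_cancel_left' diff_add_cancel add.commute[of p "y - p"])
    ultimately show "y \<in> rectangle p u v h w" unfolding mem rectangle_def by blast
  qed
qed

lemma rectangles_eq:
  assumes "0 < \<delta>" "\<delta> < 1/2"
  shows "rectangles \<delta> = {crect c u v a (\<delta> * a) | c u v a. (c, u, v, a, \<delta>) \<in> admissible}"
proof (intro equalityI subsetI)
  fix Q assume "Q \<in> rectangles \<delta>"
  then obtain p u v h where Q: "Q = rectangle p u v h (\<delta> * h)" "orthonormal u v" "0 < h"
    by (auto simp: rectangles_def orthonormal_def)
  then have "Q = crect (p + (h / 2) *\<^sub>R u + (\<delta> * h / 2) *\<^sub>R v) u v (h / 2) (\<delta> * (h / 2))"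
    by (simp add: rectangle_eq_crect)
  moreover have "(p + (h / 2) *\<^sub>R u + (\<delta> * h / 2) *\<^sub>R v, u, v, h / 2, \<delta>) \<in> admissible"
    using Q assms by (simp add: admissible_def)
  ultimately show "Q \<in> {crect c u v a (\<delta> * a) | c u v a. (c, u, v, a, \<delta>) \<in> admissible}" by blast
next
  fix Q assume "Q \<in> {crect c u v a (\<delta> * a) | c u v a. (c, u, v, a, \<delta>) \<in> admissible}"
  then obtain c u v a where Q: "Q = crect c u v a (\<delta> * a)" "orthonormal u v" "0 < a"
    by (auto simp: admissible_def)
  let ?p = "c - a *\<^sub>R u - (\<delta> * a) *\<^sub>R v"
  have "rectangle ?p u v (2 * a) (\<delta> * (2 * a)) = Q"
    unfolding Q(1) rectangle_eq_crect[OF Q(2)] by simp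
  moreover have "norm u = 1 \<and> norm v = 1 \<and> u \<bullet> v = 0 \<and> 0 < 2 * a"
    using Q by (simp add: orthonormal_def)
  ultimately show "Q \<in> rectangles \<delta>" unfolding rectangles_def by blast
qed

text \<open>
  Passage from \<open>f\<close>, measurable only for the completed measure, to a Borel function \<open>F\<close> that agrees
  with its modulus almost everywhere.
\<close>

lemma weighted_average_eq:
  assumes t: "(c, u, v, a, \<delta>) \<in> admissible"
    and AE: "AE y in lborel. ennreal (norm (f y)) = F y"
  shows "ennreal (1 / \<bar>ln \<delta>\<bar>) * average f (crect c u v a (\<delta> * a)) = weighted_average F (c, u, v, a, \<delta>)"
proof -
  have pos: "orthonormal u v" "0 < a" "0 < \<delta>" "\<delta> < 1/2" using t by (auto simp: admissible_def)
  let ?Q = "crect c u v a (\<delta> * a)"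
  have "emeasure lebesgue ?Q = ennreal (4 * (\<delta> * a\<^sup>2))"
    using pos emeasure_crect[of u v a "\<delta> * a" c] by (simp add: power2_eq_square mult_ac)
  moreover have "(\<integral>\<^sup>+y\<in>?Q. ennreal (norm (f y)) \<partial>lebesgue) = (\<integral>\<^sup>+y. F y * indicator ?Q y \<partial>lborel)"
    unfolding nn_integral_completion using AE by (intro nn_integral_cong_AE) auto
  moreover have "X / ennreal w = ennreal (1 / w) * X" if "0 < w" for X w
  proof -
    have "inverse (ennreal w) = ennreal (1 / w)"
      using that by (simp add: inverse_ennreal inverse_eq_divide)
    then show ?thesis by (simp add: divide_ennreal_def mult.commute)
  qed
  ultimately have "average f ?Q = ennreal (1 / (4 * (\<delta> * a\<^sup>2))) * (\<integral>\<^sup>+y. F y * indicator ?Q y \<partial>lborel)"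
    using pos by (simp add: average_def)
  then show ?thesis
    using pos by (simp add: weighted_average_def ennreal_mult_assoc)
qed

lemma grand_maximal_eq:
  assumes AE: "AE y in lborel. ennreal (norm (f y)) = F y"
  shows "grand_maximal f x = (SUP t\<in>{t \<in> admissible. x \<in> rect t}. weighted_average F t)"
proof (rule antisym)
  show "grand_maximal f x \<le> (SUP t\<in>{t \<in> admissible. x \<in> rect t}. weighted_average F t)"
    unfolding grand_maximal_def maximal_def SUP_mult_left_ennreal
  proof (intro SUP_least)
    fix \<delta> Q assume \<delta>: "\<delta> \<in> {0<..<1/2}" and Q: "Q \<in> {R \<in> rectangles \<delta>. x \<in> R}"
    then obtain c u v a where t: "Q = crect c u v a (\<delta> * a)" "(c, u, v, a, \<delta>) \<in> admissible"
      using rectangles_eq[of \<delta>] by auto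
    have "ennreal (1 / \<bar>ln \<delta>\<bar>) * average f Q = weighted_average F (c, u, v, a, \<delta>)"
      using weighted_average_eq[OF t(2) AE] t(1) by simp
    also have "\<dots> \<le> (SUP t\<in>{t \<in> admissible. x \<in> rect t}. weighted_average F t)"
      using Q t by (intro SUP_upper) (auto simp: rect_def)
    finally show "ennreal (1 / \<bar>ln \<delta>\<bar>) * average f Q \<le> (SUP t\<in>{t \<in> admissible. x \<in> rect t}. weighted_average F t)" .
  qed
  show "(SUP t\<in>{t \<in> admissible. x \<in> rect t}. weighted_average F t) \<le> grand_maximal f x"
  proof (rule SUP_least)
    fix t assume t: "t \<in> {t \<in> admissible. x \<in> rect t}"
    obtain c u v a \<delta> where td: "t = (c, u, v, a, \<delta>)" by (cases t)
    have \<delta>: "\<delta> \<in> {0<..<1/2}" using t by (auto simp: td admissible_def)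
    have Q: "crect c u v a (\<delta> * a) \<in> {R \<in> rectangles \<delta>. x \<in> R}"
      using t \<delta> rectangles_eq[of \<delta>] by (auto simp: td rect_def)
    have "weighted_average F t = ennreal (1 / \<bar>ln \<delta>\<bar>) * average f (crect c u v a (\<delta> * a))"
      using weighted_average_eq[OF _ AE] t by (simp add: td)
    also have "\<dots> \<le> ennreal (1 / \<bar>ln \<delta>\<bar>) * maximal \<delta> f x"
      unfolding maximal_def using Q by (intro mult_left_mono SUP_upper) auto
    also have "\<dots> \<le> grand_maximal f x"
      unfolding grand_maximal_def using \<delta> by (intro SUP_upper)
    finally show "weighted_average F t \<le> grand_maximal f x" .
  qed
qed

lemma ennreal_sqrt_le:
  assumes "Q \<le> ennreal (C\<^sup>2) * P" "0 \<le> C" "P < \<infinity>"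
  shows "ennreal_sqrt Q \<le> ennreal C * ennreal_sqrt P"
proof -
  obtain p where p: "P = ennreal p" "0 \<le> p" using assms(3) by (cases P) auto
  have Q: "Q \<le> ennreal (C\<^sup>2 * p)" using assms p by (simp add: ennreal_mult)
  then obtain q where q: "Q = ennreal q" "0 \<le> q" by (cases Q) (auto simp: top_unique)
  have "q \<le> C\<^sup>2 * p" using Q q p by simp
  then have "sqrt q \<le> sqrt (C\<^sup>2 * p)" by simp
  also have "\<dots> = C * sqrt p" using assms(2) by (simp add: real_sqrt_mult)
  finally show ?thesis using p q assms(2)
    by (simp add: ennreal_sqrt_def ennreal_leI flip: ennreal_mult)
qed

theorem theorem2:
  shows "\<exists>C::real. 0 \<le> C \<and>
    (\<forall>f \<in> L2. grand_maximal f \<in> borel_measurable lebesgue \<and>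
      L2_norm (grand_maximal f) \<le> ennreal C * L2_norm (\<lambda>x. ennreal (norm (f x))))"
proof (intro exI conjI ballI)
  let ?C = "663552 * (8 * pi)"
  show C: "0 \<le> ?C" by simp
  fix f assume f: "f \<in> L2"
  then have "f \<in> borel_measurable (completion lborel)"
    by (simp add: L2_def)
  then have "(\<lambda>x. ennreal (norm (f x))) \<in> borel_measurable (completion lborel)"
    by (rule measurable_compose[OF measurable_compose[OF _ borel_measurable_norm] measurable_ennreal])
  then obtain F where F [measurable]: "F \<in> borel_measurable lborel"
    and AE: "AE x in lborel. ennreal (norm (f x)) = F x"
    using completion_ex_borel_measurable by blast
  let ?P = "\<integral>\<^sup>+x. (F x)\<^sup>2 \<partial>lborel"
  have P: "(\<integral>\<^sup>+x. (ennreal (norm (f x)))\<^sup>2 \<partial>lebesgue) = ?P"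
    unfolding nn_integral_completion using AE by (intro nn_integral_cong_AE) auto
  then have fin: "?P < \<infinity>"
    using f by (auto simp: L2_def L2_norm_def ennreal_sqrt_def less_top split: if_splits)
  obtain t :: "nat \<Rightarrow> rectangle_params" where t: "\<And>i. t i \<in> admissible"
    "\<And>x. (SUP t\<in>{t \<in> admissible. x \<in> rect t}. weighted_average F t)
      = (SUP i. weighted_average F (t i) * indicator (rect (t i)) x)"
    by (rule countable_maximal_family[of F]) blast
  have GM: "grand_maximal f = (\<lambda>x. SUP i. weighted_average F (t i) * indicator (rect (t i)) x)"
    using grand_maximal_eq[OF AE] t(2) by auto
  have "grand_maximal f \<in> borel_measurable lborel"
    unfolding GM by (intro borel_measurable_SUP borel_measurable_times_ennreal borel_measurable_indicator) auto
  then show "grand_maximal f \<in> borel_measurable lebesgue"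
    by (rule measurable_completion)
  have "(\<integral>\<^sup>+x. (grand_maximal f x)\<^sup>2 \<partial>lebesgue) \<le> ennreal (?C\<^sup>2) * ?P"
    unfolding nn_integral_completion GM by (rule countable_maximal_L2_bound[OF F fin t(1)])
  then show "L2_norm (grand_maximal f) \<le> ennreal ?C * L2_norm (\<lambda>x. ennreal (norm (f x)))"
    unfolding L2_norm_def P by (intro ennreal_sqrt_le C fin)
qed

end
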